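(* Let $X$ be a nonzero complex Banach space with open unit ball $\mathbb{B}$, and let $\beta\in\mathbb{R}$ with $|\beta|\le\pi/3$. Let $F:\mathbb{B}\to X$ be a locally biholomorphic mapping such that for each $k=1,2,3$ there is a homogeneous polynomial $H_{F,k}:X\to\mathbb{C}$ of degree $k$ with $$\frac{D^{k+1}F(0)(x^{k+1})}{(k+1)!}=H_{F,k}(x)\,x,\qquad x\in X.$$ If $F\in\widehat{\mathcal{S}}_{\beta}(\mathbb{B})$, then for every $x_0\in X$ with $\|x_0\|=1$ and every $T_{x_0}\in T(x_0)$, $$|H_{2,2}(F)|=|A_2A_4-A_3^2|\le\cos^2\beta .$$ Moreover, the estimate is sharp: there exist a locally biholomorphic mapping $F\in\widehat{\mathcal{S}}_{\beta}(\mathbb{B})$ such that for each $k=1,2,3$ one has $\frac{D^{k+1}F(0)(x^{k+1})}{(k+1)!}=H_{F,k}(x)\,x$ for all $x\in X$ with some homogeneous polynomial $H_{F,k}:X\to\mathbb{C}$ of degree $k$, a unit vector $x_0\in X$ and $T_{x_0}\in T(x_0)$ for which equality $|A_2A_4-A_3^2|=\cos^2\beta$ holds.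
   Context: $X$ is a complex Banach space with norm $\|\cdot\|$ and $\mathbb{B}=\{x\in X:\|x\|<1\}$. For $x\in X\setminus\{0\}$, $T(x)$ is the (nonempty) set of bounded linear functionals $T_x:X\to\mathbb{C}$ with $T_x(x)=\|x\|$ and $\|T_x\|=1$. For a holomorphic mapping $F$ on $\mathbb{B}$, $DF(x)$ is the Fréchet derivative at $x$ and $D^nF(0)$ is the $n$-th Fréchet derivative at $0$ (a bounded symmetric $n$-linear operator); $D^nF(0)(x^n)$ means $D^nF(0)(x,\ldots,x)$ with $x$ repeated $n$ times. A holomorphic $F:\mathbb{B}\to X$ is normalized if $F(0)=0$ and $DF(0)=I$ (the identity); it is locally biholomorphic if $DF(x)$ is invertible with bounded inverse for every $x\in\mathbb{B}$. For $|\beta|<\pi/2$, $\widehat{\mathcal{S}}_{\beta}(\mathbb{B})$ denotes the class of $\beta$-spirallike mappings: normalized locally biholomorphic mappings $F:\mathbb{B}\to X$ such that $$\operatorname{Re}\left(e^{-i\beta}\,T_x\bigl((DF(x))^{-1}F(x)\bigr)\right)>0\qquad\text{for all }x\in\mathbb{B}\setminus\{0\},\ T_x\in T(x).$$ Given a unit vector $x_0$ and $T_{x_0}\in T(x_0)$, for $n=2,3,4$ put $$A_n=\frac{1}{n!}\,T_{x_0}\bigl(D^nF(0)(x_0^n)\bigr),$$ and $H_{2,2}(F)=\begin{vmatrix}A_2&A_3\\ A_3&A_4\end{vmatrix}=A_2A_4-A_3^2$. *)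

theory Defs
  imports "HOL-Analysis.Analysis"
begin

text \<open>
  Complex normed spaces are real normed spaces with a compatible complex scalar multiplication.
\<close>

class complex_normed_vector = real_normed_vector +
  fixes scaleC :: "complex \<Rightarrow> 'a \<Rightarrow> 'a"  (infixr "*\<^sub>C" 75)
  assumes scaleC_add_right: "c *\<^sub>C (x + y) = c *\<^sub>C x + c *\<^sub>C y"
    and scaleC_add_left: "(c + d) *\<^sub>C x = c *\<^sub>C x + d *\<^sub>C x"
    and scaleC_scaleC: "c *\<^sub>C d *\<^sub>C x = (c * d) *\<^sub>C x"
    and scaleC_of_real: "complex_of_real r *\<^sub>C x = r *\<^sub>R x"
    and norm_scaleC: "norm (c *\<^sub>C x) = cmod c * norm x"

class complex_banach = complex_normed_vector + banach

instantiation complex :: complex_banach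
begin

definition scaleC_complex :: "complex \<Rightarrow> complex \<Rightarrow> complex"
  where "scaleC_complex c z = c * z"

instance
  by standard (simp_all add: scaleC_complex_def algebra_simps norm_mult scaleR_conv_of_real)

end

definition bounded_clinear ::
    "('a::complex_normed_vector \<Rightarrow> 'b::complex_normed_vector) \<Rightarrow> bool"
  where "bounded_clinear f \<longleftrightarrow>
    bounded_linear f \<and> (\<forall>c x. f (c *\<^sub>C x) = c *\<^sub>C f x)"

definition support_functionals :: "'a::complex_normed_vector \<Rightarrow> ('a \<Rightarrow> complex) set"
  where "support_functionals x =
    {T. bounded_clinear T \<and> T x = complex_of_real (norm x) \<and> onorm T = 1}"

text \<open>
  Mappings on the open unit ball are total functions of which only the values on
  \<open>ball 0 1\<close> matter.
\<close>

definition holomorphic_on_ball :: "('a::complex_normed_vector \<Rightarrow> 'a) \<Rightarrow> bool"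
  where "holomorphic_on_ball F \<longleftrightarrow>
    (\<forall>x\<in>ball 0 1. \<exists>D. bounded_clinear D \<and> (F has_derivative D) (at x))"

text \<open>
  The Frechet derivative as an element of the normed space of bounded linear operators, so that it
  can be iterated with respect to the operator norm. The underlying operators are real-linear; for
  holomorphic mappings the derivatives are complex-linear in each argument. Junk value where the
  mapping is not differentiable.
\<close>

definition fderiv ::
    "('a::real_normed_vector \<Rightarrow> 'b::real_normed_vector) \<Rightarrow> 'a \<Rightarrow> ('a \<Rightarrow>\<^sub>L 'b)"
  where "fderiv F x = Blinfun (frechet_derivative F (at x))"

text \<open>
  \<open>fderiv_pow0 n F x\<close> is \<open>D\<^sup>nF(0)(x,\<dots>,x)\<close>. The type of the n-th derivative depends on n, so the
  orders are listed one by one; only orders up to 4 are needed.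
\<close>

definition fderiv_pow0 :: "nat \<Rightarrow> ('a::real_normed_vector \<Rightarrow> 'b::real_normed_vector) \<Rightarrow> 'a \<Rightarrow> 'b"
  where "fderiv_pow0 n F x =
    (if n = 0 then F 0
     else if n = 1 then fderiv F 0 x
     else if n = 2 then fderiv (fderiv F) 0 x x
     else if n = 3 then fderiv (fderiv (fderiv F)) 0 x x x
     else if n = 4 then fderiv (fderiv (fderiv (fderiv F))) 0 x x x x
     else undefined)"

definition normalized :: "('a::complex_normed_vector \<Rightarrow> 'a) \<Rightarrow> bool"
  where "normalized F \<longleftrightarrow> holomorphic_on_ball F \<and> F 0 = 0 \<and> fderiv F 0 = id_blinfun"

definition locally_biholomorphic :: "('a::complex_normed_vector \<Rightarrow> 'a) \<Rightarrow> bool"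
  where "locally_biholomorphic F \<longleftrightarrow> holomorphic_on_ball F \<and>
    (\<forall>x\<in>ball 0 1. \<exists>G. G o\<^sub>L fderiv F x = id_blinfun \<and> fderiv F x o\<^sub>L G = id_blinfun)"

definition spirallike :: "real \<Rightarrow> ('a::complex_normed_vector \<Rightarrow> 'a) set"
  where "spirallike \<beta> = {F. normalized F \<and> locally_biholomorphic F \<and>
    (\<forall>x\<in>ball 0 1 - {0}. \<forall>T\<in>support_functionals x.
      Re (exp (- (\<i> * complex_of_real \<beta>)) * T (inv (blinfun_apply (fderiv F x)) (F x))) > 0)}"

text \<open>
  Bounded k-linear forms; the arguments are the first k entries of a sequence, and the remaining
  entries are required to be irrelevant.
\<close>

definition bounded_multilinear_form ::
    "nat \<Rightarrow> ((nat \<Rightarrow> 'a::complex_normed_vector) \<Rightarrow> complex) \<Rightarrow> bool"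
  where "bounded_multilinear_form k L \<longleftrightarrow>
    (\<forall>v w. (\<forall>i<k. v i = w i) \<longrightarrow> L v = L w) \<and>
    (\<forall>v. \<forall>i<k. \<forall>x y. L (v(i := x + y)) = L (v(i := x)) + L (v(i := y))) \<and>
    (\<forall>v. \<forall>i<k. \<forall>c x. L (v(i := c *\<^sub>C x)) = c * L (v(i := x))) \<and>
    (\<exists>C. \<forall>v. cmod (L v) \<le> C * (\<Prod>i<k. norm (v i)))"

definition homogeneous_polynomial :: "nat \<Rightarrow> ('a::complex_normed_vector \<Rightarrow> complex) \<Rightarrow> bool"
  where "homogeneous_polynomial k H \<longleftrightarrow>
    (\<exists>L. bounded_multilinear_form k L \<and> (\<forall>x. H x = L (\<lambda>_. x)))"

definition radial_terms :: "('a::complex_normed_vector \<Rightarrow> 'a) \<Rightarrow> bool"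
  where "radial_terms F \<longleftrightarrow>
    (\<forall>k\<in>{1, 2, 3}. \<exists>H. homogeneous_polynomial k H \<and>
      (\<forall>x. fderiv_pow0 (k + 1) F x /\<^sub>R fact (k + 1) = H x *\<^sub>C x))"

definition coeff_A ::
    "('a::complex_normed_vector \<Rightarrow> 'a) \<Rightarrow> 'a \<Rightarrow> ('a \<Rightarrow> complex) \<Rightarrow> nat \<Rightarrow> complex"
  where "coeff_A F x\<^sub>0 T n = 1 / fact n * T (fderiv_pow0 n F x\<^sub>0)"

definition hankel22 ::
    "('a::complex_normed_vector \<Rightarrow> 'a) \<Rightarrow> 'a \<Rightarrow> ('a \<Rightarrow> complex) \<Rightarrow> complex"
  where "hankel22 F x\<^sub>0 T =
    coeff_A F x\<^sub>0 T 2 * coeff_A F x\<^sub>0 T 4 - (coeff_A F x\<^sub>0 T 3)\<^sup>2"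

end

theory Submission
  imports Defs "HOL-Complex_Analysis.Complex_Analysis"
begin

text \<open>
  Along a complex line \<open>z x\<close> with \<open>\<parallel>x\<parallel> = 1\<close>, the function \<open>g(z) = T(DF(z x)\<inverse> F(z x)) / z\<close> is
  holomorphic on the disc with \<open>Re (e\<^sup>-\<^sup>i\<^sup>\<beta> g) > 0\<close>. Since the terms of \<open>F\<close> of order at most 4 are
  radial, \<open>g\<close> agrees to order 3 with \<open>f / (z f')\<close> for the scalar function
  \<open>f = z + A\<^sub>2 z\<^sup>2 + A\<^sub>3 z\<^sup>3 + A\<^sub>4 z\<^sup>4\<close>, so the determinant becomes
  \<open>c\<^sub>1 c\<^sub>3 / 3 - c\<^sub>2\<^sup>2 / 4 - c\<^sub>1\<^sup>2 c\<^sub>2 / 6\<close> in the Taylor coefficients of \<open>g\<close>. Writing these through the Schur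
  coefficients of the Cayley transform of \<open>g\<close> pulls out a factor of modulus \<open>cos\<^sup>2 \<beta>\<close> and leaves an
  expression of modulus at most 1. Equality holds for \<open>F(x) = h(u(x)) x\<close> with a support functional \<open>u\<close>
  and the one-dimensional extremal \<open>z h(z)\<close>.
\<close>

subsection \<open>Complex scalars and support functionals\<close>

text \<open>The obstacle is the meaning of the coefficients: they are iterated Frechet derivatives
  in operator norm, while holomorphy only provides one complex-linear derivative at each point and
  says nothing about how it varies. An infinite-dimensional Cauchy theory is therefore built on the
  way: norming functionals from Hahn-Banach reduce each estimate to a disc, and Cauchy's integral
  formula is differentiated under the integral sign. The curve v(z) = DF(z x)^(-1) F(z x) is not
  expanded directly. A polynomial p is guessed from the scalar quotient, DF(z x)(v - p x) is shown
  to be small, and a lower bound for DF(z x) carries this over to v. The factor cos^2 \<beta> arises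
  because the Cayley transform, centred at the value at 0, makes the coefficients c_1, c_2, c_3 of g
  divisible by 1 + \<gamma> with \<gamma> = e^(2 i \<beta>), and 1 + \<gamma> = 2 e^(i \<beta>) cos
  \<beta>. After two such factors are removed, \<gamma> survives, but only |\<gamma>| = 1 matters
  for the remaining estimate.\<close>

lemma scaleC_one [simp]: "1 *\<^sub>C x = (x::'a::complex_normed_vector)"
  using scaleC_of_real[of 1 x] by simp

lemma scaleC_zero_left [simp]: "0 *\<^sub>C x = (0::'a::complex_normed_vector)"
  using scaleC_of_real[of 0 x] by simp

lemma scaleC_zero_right [simp]: "c *\<^sub>C 0 = (0::'a::complex_normed_vector)"
  using norm_scaleC[of c "0::'a"] by simp

lemma scaleC_minus_left: "(- c) *\<^sub>C x = - (c *\<^sub>C (x::'a::complex_normed_vector))"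
  using scaleC_add_left[of c "-c" x] by (simp add: add_eq_0_iff)

lemma scaleC_minus_right: "c *\<^sub>C (- x) = - (c *\<^sub>C (x::'a::complex_normed_vector))"
  using scaleC_add_right[of c x "-x"] by (simp add: add_eq_0_iff)

lemma scaleC_diff_left: "(c - d) *\<^sub>C x = c *\<^sub>C x - d *\<^sub>C (x::'a::complex_normed_vector)"
  using scaleC_add_left[of c "-d" x] by (simp add: scaleC_minus_left)

lemma scaleC_diff_right: "c *\<^sub>C (x - y) = c *\<^sub>C x - c *\<^sub>C (y::'a::complex_normed_vector)"
  using scaleC_add_right[of c x "-y"] by (simp add: scaleC_minus_right)

lemma scaleR_scaleC: "r *\<^sub>R c *\<^sub>C x = c *\<^sub>C r *\<^sub>R (x::'a::complex_normed_vector)"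
  by (simp add: scaleC_of_real[symmetric] scaleC_scaleC mult.commute)

lemma bounded_bilinear_scaleC: "bounded_bilinear (scaleC :: complex \<Rightarrow> 'a \<Rightarrow> 'a::complex_normed_vector)"
proof
  show "\<exists>K. \<forall>a b. norm (a *\<^sub>C (b::'a)) \<le> norm a * norm b * K"
    by (rule exI[of _ 1]) (simp add: norm_scaleC)
qed (simp_all add: scaleC_add_left scaleC_add_right scaleR_scaleC scaleC_of_real[symmetric]
       scaleC_scaleC scaleC_complex_def mult.commute)

lemmas bounded_linear_scaleC_left = bounded_bilinear.bounded_linear_left[OF bounded_bilinear_scaleC]
lemmas bounded_linear_scaleC_right = bounded_bilinear.bounded_linear_right[OF bounded_bilinear_scaleC]
lemmas has_derivative_scaleC [derivative_intros] = bounded_bilinear.FDERIV[OF bounded_bilinear_scaleC]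
lemmas continuous_on_scaleC [continuous_intros] =
  bounded_bilinear.continuous_on[OF bounded_bilinear_scaleC]

lemma bounded_clinear_bounded_linear: "bounded_clinear f \<Longrightarrow> bounded_linear f"
  by (simp add: bounded_clinear_def)

lemma bounded_clinear_scaleC: "bounded_clinear f \<Longrightarrow> f (c *\<^sub>C x) = c *\<^sub>C f x"
  by (simp add: bounded_clinear_def)

text \<open>Derivatives take values in operator spaces, so these must again be complex Banach spaces
  for the same lemmas to apply to \<open>fderiv F\<close>. The complex scalars act on the values;
  the domain only needs its real structure, in keeping with the real-linear operators of
  \<open>fderiv\<close>.\<close>

instantiation blinfun :: (real_normed_vector, complex_normed_vector) complex_normed_vector
begin

definition scaleC_blinfun :: "complex \<Rightarrow> 'a \<Rightarrow>\<^sub>L 'b \<Rightarrow> 'a \<Rightarrow>\<^sub>L 'b"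
  where "scaleC_blinfun c f = Blinfun (\<lambda>x. c *\<^sub>C blinfun_apply f x)"

lemma blinfun_apply_scaleC: "blinfun_apply (c *\<^sub>C f) x = c *\<^sub>C blinfun_apply f x"
  unfolding scaleC_blinfun_def
  by (subst bounded_linear_Blinfun_apply)
     (auto intro!: bounded_linear_compose[OF bounded_linear_scaleC_right blinfun.bounded_linear_right])

lemma norm_scaleC_blinfun_le: "norm (c *\<^sub>C f) \<le> cmod c * norm (f :: 'a \<Rightarrow>\<^sub>L 'b)"
proof (rule norm_blinfun_bound)
  fix x
  show "norm (blinfun_apply (c *\<^sub>C f) x) \<le> cmod c * norm f * norm x"
    using mult_left_mono[OF norm_blinfun[of f x], of "cmod c"]
    by (simp add: blinfun_apply_scaleC norm_scaleC mult.assoc)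
qed auto

instance
proof
  fix c d :: complex and f g :: "'a \<Rightarrow>\<^sub>L 'b" and r :: real
  show "c *\<^sub>C (f + g) = c *\<^sub>C f + c *\<^sub>C g"
    by (rule blinfun_eqI) (simp add: blinfun_apply_scaleC blinfun.add_left scaleC_add_right)
  show "(c + d) *\<^sub>C f = c *\<^sub>C f + d *\<^sub>C f"
    by (rule blinfun_eqI) (simp add: blinfun_apply_scaleC blinfun.add_left scaleC_add_left)
  show sc: "c *\<^sub>C d *\<^sub>C f = (c * d) *\<^sub>C f" for c d
    by (rule blinfun_eqI) (simp add: blinfun_apply_scaleC scaleC_scaleC)
  show "complex_of_real r *\<^sub>C f = r *\<^sub>R f"
    by (rule blinfun_eqI) (simp add: blinfun_apply_scaleC scaleC_of_real blinfun.scaleR_left)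
  have one: "1 *\<^sub>C f = f"
    by (rule blinfun_eqI) (simp add: blinfun_apply_scaleC)
  show "norm (c *\<^sub>C f) = cmod c * norm f"
  proof (cases "c = 0")
    case False
    \<comment> \<open>The inequality already known, used for the scalar \<open>inverse c\<close>,
      yields the reverse one.\<close>
    have "norm f = norm (inverse c *\<^sub>C c *\<^sub>C f)"
      using False by (simp add: sc one)
    also have "\<dots> \<le> inverse (cmod c) * norm (c *\<^sub>C f)"
      using norm_scaleC_blinfun_le[of "inverse c" "c *\<^sub>C f"] by (simp add: norm_inverse)
    finally have "cmod c * norm f \<le> norm (c *\<^sub>C f)"
      using False by (simp add: field_simps)
    with norm_scaleC_blinfun_le[of c f] show ?thesis by simp
  qed (use norm_scaleC_blinfun_le[of 0 f] in simp)
qed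

end

instance blinfun :: (real_normed_vector, complex_banach) complex_banach ..

section \<open>The Hahn-Banach theorem from minimal sublinear functionals\<close>

definition sublinear :: "('a::real_vector \<Rightarrow> real) \<Rightarrow> bool"
  where "sublinear p \<longleftrightarrow>
    (\<forall>x y. p (x + y) \<le> p x + p y) \<and> (\<forall>r x. 0 < r \<longrightarrow> p (r *\<^sub>R x) = r * p x)"

lemma sublinear_add: "sublinear p \<Longrightarrow> p (x + y) \<le> p x + p y"
  and sublinear_scaleR: "sublinear p \<Longrightarrow> 0 < r \<Longrightarrow> p (r *\<^sub>R x) = r * p x"
  by (auto simp: sublinear_def)

lemma sublinear_zero: "sublinear p \<Longrightarrow> p 0 = 0"
  using sublinear_scaleR[of p 2 0] by simp

lemma sublinear_minus: "sublinear p \<Longrightarrow> - p (- x) \<le> p x"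
  using sublinear_add[of p x "-x"] sublinear_zero[of p] by simp

text \<open>The infimum over t >= 0 of p(x + t y) - t p(y) has these properties: t = 0 gives the
  bound by p, t = 1 the last inequality. That inequality serves twice: it makes a minimal sublinear
  functional superadditive, and, taken at -y with p the norm, it forces a linear functional below q
  to attain the norm at y.\<close>

lemma sublinear_minorant:
  assumes p: "sublinear p"
  obtains q where "sublinear q" "\<And>x. q x \<le> p x" "\<And>x. q x \<le> p (x + y) - p y"
proof -
  define f where "f x t = p (x + t *\<^sub>R y) - t * p y" for x t
  define q where "q x = (INF t\<in>{0..}. f x t)" for x
  have scal: "p (t *\<^sub>R y) = t * p y" if "t \<ge> 0" for t
    using that sublinear_scaleR[OF p, of t y] sublinear_zero[OF p] by (cases "t = 0") auto
  \<comment> \<open>Since p(t y) = t p(y), subadditivity keeps all values above -p(-x), so the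
    infimum is finite.\<close>
  have lower: "- p (- x) \<le> f x t" if "t \<ge> 0" for x t
    using sublinear_add[OF p, of "x + t *\<^sub>R y" "- x"] scal[OF that] by (simp add: f_def)
  have bdd: "bdd_below (f x ` {0..})" for x
    using lower by (intro bdd_belowI[of _ "- p (- x)"]) auto
  have q_le: "q x \<le> f x t" if "t \<ge> 0" for x t
    unfolding q_def by (rule cINF_lower[OF bdd]) (use that in auto)
  have q_ge: "c \<le> q x" if "\<And>t. t \<ge> 0 \<Longrightarrow> c \<le> f x t" for c x
    unfolding q_def by (rule cINF_greatest) (use that in auto)
  have add: "q (a + b) \<le> q a + q b" for a b
  proof -
    have "q (a + b) - f a s \<le> q b" if s: "s \<ge> 0" for s
    proof (rule q_ge)
      fix t :: real assume t: "t \<ge> 0"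
      have "f (a + b) (s + t) \<le> f a s + f b t"
        using sublinear_add[OF p, of "a + s *\<^sub>R y" "b + t *\<^sub>R y"]
        by (simp add: f_def algebra_simps)
      with q_le[of "s + t" "a + b"] s t show "q (a + b) - f a s \<le> f b t" by simp
    qed
    then have "q (a + b) - q b \<le> q a"
      by (intro q_ge) (simp add: algebra_simps)
    then show ?thesis by simp
  qed
  have le: "q (r *\<^sub>R x) \<le> r * q x" if r: "0 < r" for r x
  proof -
    have "q (r *\<^sub>R x) / r \<le> f x t" if "t \<ge> 0" for t
    proof -
      have "q (r *\<^sub>R x) \<le> f (r *\<^sub>R x) (r * t)" using r that by (intro q_le) auto
      also have "\<dots> = r * f x t"
        using sublinear_scaleR[OF p r, of "x + t *\<^sub>R y"] by (simp add: f_def algebra_simps)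
      finally show ?thesis using r by (simp add: field_simps)
    qed
    then have "q (r *\<^sub>R x) / r \<le> q x" by (rule q_ge)
    then show ?thesis using r by (simp add: field_simps)
  qed
  have "q (r *\<^sub>R x) = r * q x" if r: "0 < r" for r x
  proof (rule antisym[OF le[OF r]])
    have "q (inverse r *\<^sub>R r *\<^sub>R x) \<le> inverse r * q (r *\<^sub>R x)" using r by (intro le) auto
    then show "r * q x \<le> q (r *\<^sub>R x)" using r by (simp add: field_simps)
  qed
  with add have "sublinear q" by (simp add: sublinear_def)
  moreover have "q x \<le> p x" for x using q_le[of 0 x] by (simp add: f_def)
  moreover have "q x \<le> p (x + y) - p y" for x using q_le[of 1 x] by (simp add: f_def)
  ultimately show ?thesis by (rule that)
qed

text \<open>A pointwise minimal sublinear functional is additive: otherwise it has a proper minorant of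
  the preceding kind.\<close>

lemma linear_minorant_exists:
  fixes p :: "'a::real_vector \<Rightarrow> real"
  assumes p: "sublinear p"
  obtains f where "linear f" "\<And>x. f x \<le> p x"
proof -
  define A where "A = {q. sublinear q \<and> q \<le> p}"
  \<comment> \<open>The order is reversed, so that a maximal element in Zorn's lemma is a minimal
    sublinear functional.\<close>
  define P where "P = (\<lambda>q r :: 'a \<Rightarrow> real. r \<le> q)"
  have "\<exists>m\<in>A. \<forall>a\<in>A. P m a \<longrightarrow> a = m"
  proof (rule predicate_Zorn)
    show "partial_order_on A (relation_of P A)"
      by (auto simp: P_def relation_of_def partial_order_on_def preorder_on_def refl_on_def
          trans_def antisym_def)
  next
    fix C assume C: "C \<in> Chains (relation_of P A)"
    show "\<exists>u\<in>A. \<forall>a\<in>C. P a u"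
    proof (cases "C = {}")
      case True
      then show ?thesis using p by (auto simp: A_def)
    next
      case False
      have CA: "C \<subseteq> A" by (rule Chains_relation_of[OF C])
      have comp: "q \<le> r \<or> r \<le> q" if "q \<in> C" "r \<in> C" for q r
        using C that by (auto simp: Chains_def relation_of_def P_def)
      define u where "u x = (INF q\<in>C. q x)" for x
      have lower: "- p (- x) \<le> q x" if "q \<in> C" for q x
      proof -
        have "sublinear q" "q (-x) \<le> p (-x)" using that CA by (auto simp: A_def le_fun_def)
        then show ?thesis using sublinear_minus[of q x] by linarith
      qed
      have bdd: "bdd_below ((\<lambda>q. q x) ` C)" for x
        using lower by (intro bdd_belowI[of _ "- p (- x)"]) auto
      have u_le: "u x \<le> q x" if "q \<in> C" for q x
        unfolding u_def by (rule cINF_lower[OF bdd that])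
      have u_ge: "c \<le> u x" if "\<And>q. q \<in> C \<Longrightarrow> c \<le> q x" for c x
        unfolding u_def by (rule cINF_greatest[OF False that])
      have add: "u (a + b) \<le> u a + u b" for a b
      proof -
        have "u (a + b) - q a \<le> u b" if q: "q \<in> C" for q
        proof (rule u_ge)
          fix r assume r: "r \<in> C"
          have sub: "sublinear q" "sublinear r" using q r CA by (auto simp: A_def)
          \<comment> \<open>Of two members of the chain the smaller one can be used at both
            arguments. Comparability is essential, as an infimum of sublinear functionals need not
            be subadditive.\<close>
          from comp[OF q r] show "u (a + b) - q a \<le> r b"
          proof
            assume "q \<le> r"
            then have "q b \<le> r b" by (simp add: le_fun_def)
            then show ?thesis
              using u_le[OF q, of "a + b"] sublinear_add[OF sub(1), of a b] by linarith
          next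
            assume "r \<le> q"
            then have "r a \<le> q a" by (simp add: le_fun_def)
            then show ?thesis
              using u_le[OF r, of "a + b"] sublinear_add[OF sub(2), of a b] by linarith
          qed
        qed
        then have "u (a + b) - u b \<le> u a"
          by (intro u_ge) (simp add: algebra_simps)
        then show ?thesis by simp
      qed
      have le: "u (r *\<^sub>R x) \<le> r * u x" if r: "0 < r" for r x
      proof -
        have "u (r *\<^sub>R x) / r \<le> q x" if "q \<in> C" for q
        proof -
          have "sublinear q" using that CA by (auto simp: A_def)
          then show ?thesis
            using u_le[OF that, of "r *\<^sub>R x"] sublinear_scaleR[of q r x] r
            by (simp add: field_simps)
        qed
        then have "u (r *\<^sub>R x) / r \<le> u x" by (rule u_ge)
        then show ?thesis using r by (simp add: field_simps)
      qed
      have "u (r *\<^sub>R x) = r * u x" if r: "0 < r" for r x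
      proof (rule antisym[OF le[OF r]])
        have "u (inverse r *\<^sub>R r *\<^sub>R x) \<le> inverse r * u (r *\<^sub>R x)" using r by (intro le) auto
        then show "r * u x \<le> u (r *\<^sub>R x)" using r by (simp add: field_simps)
      qed
      with add have "sublinear u" by (simp add: sublinear_def)
      moreover obtain q where q: "q \<in> C" using False by auto
      have "u \<le> p"
      proof (rule le_funI)
        fix x
        have "q x \<le> p x" using q CA by (auto simp: A_def le_fun_def)
        with u_le[OF q, of x] show "u x \<le> p x" by linarith
      qed
      ultimately show ?thesis using u_le by (auto simp: A_def P_def le_fun_def)
    qed
  qed
  then obtain m where m: "sublinear m" "m \<le> p"
    and min: "\<And>q. sublinear q \<Longrightarrow> q \<le> m \<Longrightarrow> q = m"
    unfolding A_def P_def by (metis (mono_tags, lifting) mem_Collect_eq order.trans)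
  have add: "m (x + y) = m x + m y" for x y
  proof -
    obtain q where q: "sublinear q" "\<And>x. q x \<le> m x" "\<And>x. q x \<le> m (x + y) - m y"
      using sublinear_minorant[OF m(1), of y] by blast
    \<comment> \<open>By minimality the minorant is m itself, and its last property becomes m x + m
      y <= m (x + y).\<close>
    have "q = m" using q by (intro min) (auto simp: le_fun_def)
    with q(3)[of x] sublinear_add[OF m(1), of x y] show ?thesis by simp
  qed
  have neg: "m (- x) = - m x" for x
    using add[of x "- x"] sublinear_zero[OF m(1)] by simp
  have "m (r *\<^sub>R x) = r * m x" for r x
  proof -
    consider "r > 0" | "r = 0" | "r < 0" by linarith
    then show ?thesis
    proof cases
      case 3
      then show ?thesis
        using sublinear_scaleR[OF m(1), of "- r" x] neg[of "r *\<^sub>R x"] by simp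
    qed (simp_all add: sublinear_scaleR[OF m(1)] sublinear_zero[OF m(1)])
  qed
  with add have "linear m" by (intro linearI) auto
  with m(2) show ?thesis by (intro that) (auto simp: le_fun_def)
qed

lemma support_functional_norm_le:
  "T \<in> support_functionals x \<Longrightarrow> cmod (T y) \<le> norm y"
  using onorm[of T y] by (auto simp: support_functionals_def bounded_clinear_def)

lemma support_functionalI:
  assumes "bounded_clinear T" "T x = complex_of_real (norm x)" "x \<noteq> 0"
    and "\<And>y. cmod (T y) \<le> norm y"
  shows "T \<in> support_functionals x"
proof -
  have "onorm T \<le> 1" by (rule onorm_bound) (use assms(4) in auto)
  moreover have "norm (T x) \<le> onorm T * norm x"
    using assms(1) by (intro onorm) (simp add: bounded_clinear_def)
  then have "1 \<le> onorm T" using assms(2,3) by simp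
  ultimately show ?thesis using assms by (simp add: support_functionals_def)
qed

text \<open>A real-linear f below the minorant of the norm satisfies f(-x) <= - norm x, hence f x =
  norm x. The complex functional is f(z) - i f(i z); rotating z until its value is a nonnegative
  real number bounds the modulus by f, and so by the norm.\<close>

lemma support_functional_exists:
  fixes x :: "'a::complex_normed_vector"
  assumes "x \<noteq> 0"
  obtains T where "T \<in> support_functionals x"
proof -
  have "sublinear (norm :: 'a \<Rightarrow> real)" by (auto simp: sublinear_def norm_triangle_ineq)
  then obtain q where q: "sublinear q" "\<And>z. q z \<le> norm z" "\<And>z. q z \<le> norm (z + x) - norm x"
    using sublinear_minorant[of norm x] by blast
  obtain f where f: "linear f" "\<And>z. f z \<le> q z"
    using linear_minorant_exists[OF q(1)] by blast
  interpret f: linear f by fact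
  have fle: "f z \<le> norm z" for z using f(2)[of z] q(2)[of z] by linarith
  have "f (- x) \<le> - norm x" using f(2)[of "- x"] q(3)[of "- x"] by simp
  then have fx: "f x = norm x" using fle[of x] by (simp add: f.neg)
  define T where "T z = Complex (f z) (- f (\<i> *\<^sub>C z))" for z
  have Tadd: "T (y + z) = T y + T z" for y z
    by (simp add: T_def complex_eq_iff f.add scaleC_add_right)
  have TR: "T (r *\<^sub>R z) = r *\<^sub>R T z" for r z
    by (simp add: T_def complex_eq_iff f.scaleR scaleR_scaleC[symmetric])
  have Ti: "T (\<i> *\<^sub>C z) = \<i> * T z" for z
    by (simp add: T_def complex_eq_iff scaleC_scaleC scaleC_minus_left f.neg)
  have TC: "T (c *\<^sub>C z) = c * T z" for c z
  proof -
    have "c *\<^sub>C z = Re c *\<^sub>R z + \<i> *\<^sub>C Im c *\<^sub>R z"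
      by (subst (1) complex_eq[of c])
         (simp add: scaleC_add_left scaleC_scaleC[symmetric] scaleC_of_real)
    then have "T (c *\<^sub>C z) = Re c * T z + \<i> * (Im c * T z)"
      by (simp add: Tadd TR Ti scaleR_conv_of_real)
    also have "\<dots> = c * T z" by (subst (3) complex_eq[of c]) (simp add: algebra_simps)
    finally show ?thesis .
  qed
  have Tle: "cmod (T z) \<le> norm z" for z
  proof (cases "T z = 0")
    case False
    define c where "c = cnj (sgn (T z))"
    have "c * T z = cmod (T z)"
      using False complex_norm_square[of "T z"]
      by (simp add: c_def sgn_eq power2_eq_square mult.commute divide_eq_eq)
    then have "f (c *\<^sub>C z) = cmod (T z)"
      using TC[of c z] by (simp add: T_def complex_eq_iff)
    moreover have "norm (c *\<^sub>C z) = norm z" using False by (simp add: norm_scaleC c_def norm_sgn)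
    ultimately show ?thesis using fle[of "c *\<^sub>C z"] by simp
  qed simp
  have bl: "bounded_linear T"
    by (rule bounded_linear_intro[of _ 1]) (auto simp: Tadd TR Tle)
  \<comment> \<open>The real part of T x is already norm x, and |T x| <= norm x leaves nothing for
    the imaginary part.\<close>
  have "Im (T x) = 0"
  proof -
    have "(cmod (T x))\<^sup>2 \<le> (norm x)\<^sup>2" by (rule power_mono[OF Tle]) auto
    then show ?thesis by (simp add: cmod_power2 T_def fx)
  qed
  then have "T x = complex_of_real (norm x)" by (simp add: complex_eq_iff) (simp add: T_def fx)
  moreover have "bounded_clinear T" using bl TC by (simp add: bounded_clinear_def scaleC_complex_def)
  ultimately show ?thesis using assms Tle that by (blast intro: support_functionalI)
qed

subsection \<open>Holomorphic mappings between complex Banach spaces\<close>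

text \<open>In contrast to \<open>holomorphic_on_ball\<close>, domain and codomain may differ, so
  the notion applies to operator-valued derivatives and can be iterated.\<close>

definition holomorphic_map_on ::
    "('a::complex_normed_vector \<Rightarrow> 'b::complex_normed_vector) \<Rightarrow> 'a set \<Rightarrow> bool"  (infixl "holomorphic'_map'_on" 50)
  where "F holomorphic_map_on U \<longleftrightarrow>
    (\<forall>x\<in>U. \<exists>D. bounded_clinear D \<and> (F has_derivative D) (at x))"

lemma holomorphic_map_onI:
  assumes "\<And>x. x \<in> U \<Longrightarrow> (F has_derivative D x) (at x)"
    and "\<And>x c h. x \<in> U \<Longrightarrow> D x (c *\<^sub>C h) = c *\<^sub>C D x h"
  shows "F holomorphic_map_on U"
  using assms has_derivative_bounded_linear
  unfolding holomorphic_map_on_def bounded_clinear_def by blast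

lemma fderiv_eqI: "(F has_derivative D) (at x) \<Longrightarrow> blinfun_apply (fderiv F x) = D"
  by (simp add: fderiv_def frechet_derivative_at[symmetric] bounded_linear_Blinfun_apply
      has_derivative_bounded_linear)

lemma has_derivative_fderiv:
  assumes "F holomorphic_map_on U" "x \<in> U"
  shows "(F has_derivative blinfun_apply (fderiv F x)) (at x)"
  using assms fderiv_eqI unfolding holomorphic_map_on_def by metis

lemma fderiv_scaleC:
  assumes "F holomorphic_map_on U" "x \<in> U"
  shows "blinfun_apply (fderiv F x) (c *\<^sub>C h) = c *\<^sub>C blinfun_apply (fderiv F x) h"
  using assms fderiv_eqI unfolding holomorphic_map_on_def bounded_clinear_def by metis

lemma holomorphic_map_on_continuous:
  "F holomorphic_map_on U \<Longrightarrow> continuous_on U F"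
  using has_derivative_fderiv has_derivative_continuous continuous_at_imp_continuous_on by metis

lemma has_derivative_along_line:
  assumes F: "F holomorphic_map_on U" and "y + z *\<^sub>C k \<in> U"
  shows "((\<lambda>z. F (y + z *\<^sub>C k)) has_derivative
           (\<lambda>d. d *\<^sub>C blinfun_apply (fderiv F (y + z *\<^sub>C k)) k)) (at z)"
proof -
  have "((\<lambda>z. y + z *\<^sub>C k) has_derivative (\<lambda>d. d *\<^sub>C k)) (at z)"
    by (auto intro!: derivative_eq_intros)
  from has_derivative_compose[OF this has_derivative_fderiv[OF assms]]
  show ?thesis by (simp add: fderiv_scaleC[OF assms])
qed

lemma field_derivative_along_line:
  assumes F: "F holomorphic_map_on U" and U: "y + z *\<^sub>C k \<in> U" and T: "bounded_clinear T"
  shows "((\<lambda>z. T (F (y + z *\<^sub>C k))) has_field_derivative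
           T (blinfun_apply (fderiv F (y + z *\<^sub>C k)) k)) (at z)"
proof -
  have "((\<lambda>z. T (F (y + z *\<^sub>C k))) has_derivative
           (\<lambda>d. T (d *\<^sub>C blinfun_apply (fderiv F (y + z *\<^sub>C k)) k))) (at z)"
    by (rule bounded_linear.has_derivative[OF bounded_clinear_bounded_linear[OF T]
          has_derivative_along_line[OF F U]])
  then show ?thesis
    by (rule has_derivative_imp_has_field_derivative)
       (simp add: bounded_clinear_scaleC[OF T] scaleC_complex_def)
qed

lemma holomorphic_along_line:
  assumes F: "F holomorphic_map_on U" and "\<And>z. z \<in> S \<Longrightarrow> y + z *\<^sub>C k \<in> U" and T: "bounded_clinear T"
  shows "(\<lambda>z. T (F (y + z *\<^sub>C k))) holomorphic_on S"
  using field_derivative_along_line[OF F _ T] assms(2)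
  by (metis (no_types, lifting) field_differentiable_at_within field_differentiable_def
      holomorphic_on_def)

lemma dist_line [simp]: "dist x (x + z *\<^sub>C k) = cmod z * norm k"
  by (simp add: dist_norm norm_scaleC norm_minus_commute)

section \<open>Cauchy estimates and holomorphy of the derivative in operator norm\<close>

text \<open>A functional norming DF(x) k reduces this to the one-variable Cauchy inequality for
  T(F(x + z k)) on the disc of radius r / norm k.\<close>

lemma fderiv_norm_le:
  fixes F :: "'a::complex_normed_vector \<Rightarrow> 'b::complex_normed_vector"
  assumes F: "F holomorphic_map_on U" and U: "cball x r \<subseteq> U" and r: "r > 0"
    and M: "\<And>y. y \<in> cball x r \<Longrightarrow> norm (F y) \<le> M"
  shows "norm (fderiv F x) \<le> M / r"
proof (rule norm_blinfun_bound)
  have "0 \<le> M" by (rule order_trans[OF norm_ge_zero M[of x]]) (use r in auto)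
  then show "0 \<le> M / r" using r by simp
  fix k :: 'a
  show "norm (blinfun_apply (fderiv F x) k) \<le> M / r * norm k"
  proof (cases "blinfun_apply (fderiv F x) k = 0")
    case False
    then have k: "k \<noteq> 0" by auto
    obtain T where T: "T \<in> support_functionals (blinfun_apply (fderiv F x) k)"
      using support_functional_exists[OF False] by blast
    then have bT: "bounded_clinear T" by (simp add: support_functionals_def)
    define s where "s = r / norm k"
    have s: "s > 0" using k r by (simp add: s_def)
    have in_cb: "x + z *\<^sub>C k \<in> cball x r" if "cmod z \<le> s" for z
      using that k by (simp add: s_def field_simps)
    let ?g = "\<lambda>z. T (F (x + z *\<^sub>C k))"
    have hol: "?g holomorphic_on cball 0 s"
      by (rule holomorphic_along_line[OF F _ bT]) (use in_cb U in auto)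
    have "norm ((deriv ^^ 1) ?g 0) \<le> fact 1 * M / s ^ 1"
    proof (rule Cauchy_inequality[OF _ _ s])
      show "?g holomorphic_on ball 0 s" using hol by (rule holomorphic_on_subset) auto
      show "continuous_on (cball 0 s) ?g" using hol by (rule holomorphic_on_imp_continuous_on)
      fix z assume "cmod (0 - z) = s"
      then have "norm (F (x + z *\<^sub>C k)) \<le> M" using in_cb[of z] M by simp
      then show "cmod (?g z) \<le> M" using support_functional_norm_le[OF T] order_trans by blast
    qed
    moreover have "deriv ?g 0 = T (blinfun_apply (fderiv F x) k)"
      using field_derivative_along_line[OF F _ bT, of x 0 k] U r
      by (intro DERIV_imp_deriv) (auto simp: subset_iff)
    moreover have "cmod (T (blinfun_apply (fderiv F x) k)) = norm (blinfun_apply (fderiv F x) k)"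
      using T by (simp add: support_functionals_def)
    ultimately show ?thesis by (simp add: s_def)
  qed (use r \<open>0 \<le> M\<close> in auto)
qed

text \<open>Allows the variation of \<open>fderiv F\<close> to be bounded by a Cauchy estimate for a
  difference of translates.\<close>

lemma holomorphic_map_on_translate_diff:
  assumes F: "F holomorphic_map_on U" and "\<And>z. z \<in> V \<Longrightarrow> z \<in> U \<and> z + a \<in> U"
  shows "(\<lambda>z. F (z + a) - F z) holomorphic_map_on V"
    and "z \<in> V \<Longrightarrow> fderiv (\<lambda>z. F (z + a) - F z) z = fderiv F (z + a) - fderiv F z"
proof -
  have D: "((\<lambda>z. F (z + a) - F z) has_derivative
      (\<lambda>h. blinfun_apply (fderiv F (z + a)) h - blinfun_apply (fderiv F z) h)) (at z)"
    if "z \<in> V" for z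
  proof (rule has_derivative_diff)
    have "((\<lambda>z. z + a) has_derivative (\<lambda>h. h)) (at z)" by (auto intro!: derivative_eq_intros)
    from has_derivative_compose[OF this has_derivative_fderiv[OF F]]
    show "((\<lambda>z. F (z + a)) has_derivative blinfun_apply (fderiv F (z + a))) (at z)"
      using assms(2) that by simp
    show "(F has_derivative blinfun_apply (fderiv F z)) (at z)"
      using assms(2) that by (blast intro: has_derivative_fderiv[OF F])
  qed
  show "(\<lambda>z. F (z + a) - F z) holomorphic_map_on V"
    by (rule holomorphic_map_onI[OF D]) (use assms(2) in \<open>auto simp: fderiv_scaleC[OF F] scaleC_diff_right\<close>)
  show "fderiv (\<lambda>z. F (z + a) - F z) z = fderiv F (z + a) - fderiv F z" if "z \<in> V"
    using fderiv_eqI[OF D[OF that]] by (intro blinfun_eqI) (simp add: blinfun.diff_left)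
qed

text \<open>Each Cauchy estimate costs a margin r. One bounds \<open>fderiv F\<close> by M / r on
  the ball of radius 2 r; by the mean value inequality F(z + a) - F(z) is at most M / r * norm a for
  z within r of y; a second Cauchy estimate, for this difference, gives the other factor 1 /
  r.\<close>

lemma fderiv_Lipschitz:
  fixes F :: "'a::complex_normed_vector \<Rightarrow> 'b::complex_normed_vector"
  assumes F: "F holomorphic_map_on U" and U: "cball x (3 * r) \<subseteq> U" and r: "r > 0"
    and M: "\<And>y. y \<in> cball x (3 * r) \<Longrightarrow> norm (F y) \<le> M"
    and y: "y \<in> cball x r" "y' \<in> cball x r"
  shows "norm (fderiv F y' - fderiv F y) \<le> M / r\<^sup>2 * norm (y' - y)"
proof -
  have bound: "norm (fderiv F z) \<le> M / r" if z: "z \<in> cball x (2 * r)" for z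
  proof (rule fderiv_norm_le[OF F _ r])
    have *: "w \<in> cball x (3 * r)" if "w \<in> cball z r" for w
      using that z dist_triangle[of x w z] by simp
    show "cball z r \<subseteq> U" using * U by blast
    show "norm (F w) \<le> M" if "w \<in> cball z r" for w using *[OF that] by (rule M)
  qed
  have lip: "norm (F z' - F z) \<le> M / r * norm (z' - z)"
    if "z \<in> cball x (2 * r)" "z' \<in> cball x (2 * r)" for z z'
  proof (rule differentiable_bound[where S = "cball x (2 * r)"])
    fix w assume w: "w \<in> cball x (2 * r)"
    then have "w \<in> U" using U r by (auto simp: subset_iff)
    then show "(F has_derivative blinfun_apply (fderiv F w)) (at w within cball x (2 * r))"
      by (rule has_derivative_at_withinI[OF has_derivative_fderiv[OF F]])
    show "onorm (blinfun_apply (fderiv F w)) \<le> M / r"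
      using bound[OF w] by (simp add: norm_blinfun.rep_eq)
  qed (use that in auto)
  define a where "a = y' - y"
  have *: "z \<in> cball x (2 * r) \<and> z + a \<in> cball x (2 * r)" if "z \<in> cball y r" for z
  proof -
    have "dist y' (z + a) = dist y z" by (simp add: a_def dist_norm)
    then show ?thesis
      using that y dist_triangle[of x z y] dist_triangle[of x "z + a" y'] by simp
  qed
  have 3: "cball x (2 * r) \<subseteq> U" using U r by (auto simp: subset_iff)
  let ?G = "\<lambda>z. F (z + a) - F z"
  have G: "?G holomorphic_map_on cball y r"
    by (rule holomorphic_map_on_translate_diff(1)[OF F]) (use * 3 in blast)
  have "norm (fderiv ?G y) \<le> (M / r * norm a) / r"
  proof (rule fderiv_norm_le[OF G order_refl r])
    fix z assume "z \<in> cball y r"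
    then show "norm (F (z + a) - F z) \<le> M / r * norm a" using lip[of z "z + a"] * by simp
  qed
  moreover have "fderiv ?G y = fderiv F (y + a) - fderiv F y"
    by (rule holomorphic_map_on_translate_diff(2)[OF F, of "cball y r"]) (use * 3 r in auto)
  ultimately show ?thesis by (simp add: a_def power2_eq_square)
qed

lemma locally_bounded_ball:
  assumes F: "F holomorphic_map_on U" and "open U" "x \<in> U"
  obtains r M where "r > 0" "cball x r \<subseteq> U" "\<And>y. y \<in> cball x r \<Longrightarrow> norm (F y) \<le> M"
proof -
  have "isCont F x" using has_derivative_fderiv[OF F] assms(3) has_derivative_continuous by blast
  then obtain d where d: "d > 0" "\<And>y. dist y x < d \<Longrightarrow> dist (F y) (F x) < 1"
    unfolding continuous_at_eps_delta by (metis zero_less_one)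
  obtain e where e: "e > 0" "cball x e \<subseteq> U" using assms open_contains_cball by blast
  show ?thesis
  proof (rule that[of "min e (d/2)"])
    show "norm (F y) \<le> norm (F x) + 1" if "y \<in> cball x (min e (d/2))" for y
    proof -
      have "dist (F y) (F x) < 1" using that d(1) by (intro d(2)) (auto simp: dist_commute)
      then show ?thesis using norm_triangle_ineq2[of "F y" "F x"] by (simp add: dist_norm)
    qed
  qed (use d e in auto)
qed

text \<open>The constant in \<open>fderiv_Lipschitz\<close> is proportional to the bound on the map,
  so the quadratic remainder of the evaluation at k is bounded by a fixed multiple of norm k. This
  uniformity in k turns strong differentiability into differentiability in operator norm.\<close>

lemma norm_holomorphic_if_pointwise:
  fixes G :: "'a::complex_normed_vector \<Rightarrow> 'b::complex_normed_vector \<Rightarrow>\<^sub>L 'c::complex_normed_vector"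
  assumes pt: "\<And>k. (\<lambda>y. blinfun_apply (G y) k) holomorphic_map_on ball x R" and R: "R > 0"
    and bd: "\<And>y. y \<in> ball x R \<Longrightarrow> norm (G y) \<le> M"
  shows "\<exists>D. bounded_clinear D \<and> (G has_derivative D) (at x)"
proof -
  define r where "r = R / 4"
  have r: "r > 0" using R by (simp add: r_def)
  have sub: "cball x (3 * r) \<subseteq> ball x R" using R by (auto simp: r_def)
  have M0: "M \<ge> 0" by (rule order_trans[OF norm_ge_zero bd[of x]]) (use R in auto)
  let ?g = "\<lambda>k y. blinfun_apply (G y) k"
  have bdk: "norm (?g k y) \<le> M * norm k" if "y \<in> cball x (3 * r)" for k y
  proof -
    have "norm (?g k y) \<le> norm (G y) * norm k" by (rule norm_blinfun)
    also have "\<dots> \<le> M * norm k" using bd sub that by (intro mult_right_mono) auto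
    finally show ?thesis .
  qed
  have xin: "x \<in> ball x R" using R by simp
  \<comment> \<open>The candidate derivative is assembled from those of the evaluations; its
    linearity in k comes from uniqueness of derivatives.\<close>
  define B where "B h = (\<lambda>k. blinfun_apply (fderiv (?g k) x) h)" for h
  have der: "(?g k has_derivative (\<lambda>h. B h k)) (at x)" for k
    using has_derivative_fderiv[OF pt xin, of k] by (simp add: B_def)
  have Badd: "B h (k + l) = B h k + B h l" for h k l
  proof -
    have "(?g (k + l) has_derivative (\<lambda>h. B h k + B h l)) (at x)"
      unfolding blinfun.add_right by (intro has_derivative_add der)
    from has_derivative_unique[OF der this] show ?thesis by meson
  qed
  have BscR: "B h (a *\<^sub>R k) = a *\<^sub>R B h k" for h k a
  proof -
    have "(?g (a *\<^sub>R k) has_derivative (\<lambda>h. a *\<^sub>R B h k)) (at x)"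
      unfolding blinfun.scaleR_right by (intro has_derivative_scaleR_right der)
    from has_derivative_unique[OF der this] show ?thesis by meson
  qed
  have Bbd: "norm (B h k) \<le> norm k * (M / (3 * r) * norm h)" for h k
  proof -
    have "norm (B h k) \<le> norm (fderiv (?g k) x) * norm h" unfolding B_def by (rule norm_blinfun)
    also have "\<dots> \<le> (M * norm k / (3 * r)) * norm h"
      by (intro mult_right_mono fderiv_norm_le[OF pt sub]) (use r bdk in auto)
    finally show ?thesis by (simp add: field_simps)
  qed
  have Bbl: "bounded_linear (B h)" for h
    by (rule bounded_linear_intro[OF Badd BscR Bbd])
  define D where "D h = Blinfun (B h)" for h
  have D: "blinfun_apply (D h) k = B h k" for h k
    by (simp add: D_def bounded_linear_Blinfun_apply[OF Bbl])
  have Dadd: "D (h + h') = D h + D h'" for h h'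
    by (rule blinfun_eqI) (simp add: D blinfun.add_left, simp add: B_def blinfun.add_right)
  have DscR: "D (a *\<^sub>R h) = a *\<^sub>R D h" for h a
    by (rule blinfun_eqI) (simp add: D blinfun.scaleR_left, simp add: B_def blinfun.scaleR_right)
  have DscC: "D (c *\<^sub>C h) = c *\<^sub>C D h" for h c
    by (rule blinfun_eqI) (simp add: D blinfun_apply_scaleC, simp add: B_def fderiv_scaleC[OF pt xin])
  have "norm (D h) \<le> norm h * (M / (3 * r))" for h
    by (rule norm_blinfun_bound) (use M0 r Bbd[of h] in \<open>auto simp: D mult_ac\<close>)
  then have Dbl: "bounded_linear D" by (intro bounded_linear_intro[OF Dadd DscR])
  have rem: "norm (G y - G x - D (y - x)) \<le> M / r\<^sup>2 * (norm (y - x))\<^sup>2" if y: "y \<in> cball x r" for y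
  proof (rule norm_blinfun_bound)
    fix k
    have "norm (?g k y - ?g k x - blinfun_apply (fderiv (?g k) x) (y - x))
      \<le> norm (y - x) * (M * norm k / r\<^sup>2 * norm (y - x))"
    proof (rule differentiable_bound_linearization[where S = "cball x (norm (y - x))"])
      show "x + t *\<^sub>R (y - x) \<in> cball x (norm (y - x))" if "t \<in> {0..1}" for t
        using that by (simp add: dist_norm mult_left_le_one_le)
    next
      fix z assume z: "z \<in> cball x (norm (y - x))"
      then have z': "z \<in> cball x r" using y by (simp add: dist_norm norm_minus_commute)
      then have "z \<in> ball x R" using r by (simp add: r_def)
      then show "(?g k has_derivative blinfun_apply (fderiv (?g k) z)) (at z within cball x (norm (y - x)))"
        by (rule has_derivative_at_withinI[OF has_derivative_fderiv[OF pt]])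
      have "norm (fderiv (?g k) z - fderiv (?g k) x) \<le> M * norm k / r\<^sup>2 * norm (z - x)"
        by (rule fderiv_Lipschitz[OF pt sub r bdk]) (use z' r in auto)
      also have "\<dots> \<le> M * norm k / r\<^sup>2 * norm (y - x)"
        using z M0 by (intro mult_left_mono) (auto simp: dist_norm norm_minus_commute)
      finally show "onorm (blinfun_apply (fderiv (?g k) z) - blinfun_apply (fderiv (?g k) x)) \<le> M * norm k / r\<^sup>2 * norm (y - x)"
        by (simp add: norm_blinfun.rep_eq minus_blinfun.rep_eq fun_diff_def)
    qed auto
    then show "norm (blinfun_apply (G y - G x - D (y - x)) k)
        \<le> M / r\<^sup>2 * (norm (y - x))\<^sup>2 * norm k"
      by (simp add: blinfun.diff_left D B_def power2_eq_square mult_ac)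
  qed (use M0 in auto)
  have "(G has_derivative D) (at x)"
  proof (rule has_derivativeI_sandwich[of r])
    fix y assume "y \<noteq> x" and "dist y x < r"
    then have "norm (G y - G x - D (y - x)) \<le> M / r\<^sup>2 * (norm (y - x))\<^sup>2"
      by (intro rem) (simp add: dist_commute)
    then show "norm ((G y - G x) - D (y - x)) / norm (y - x) \<le> M / r\<^sup>2 * norm (y - x)"
      using \<open>y \<noteq> x\<close> by (simp add: field_simps power2_eq_square)
  next
    have "((\<lambda>y. M / r\<^sup>2 * norm (y - x)) \<longlongrightarrow> M / r\<^sup>2 * norm (x - x)) (at x)"
      by (intro tendsto_intros)
    then show "((\<lambda>y. M / r\<^sup>2 * norm (y - x)) \<longlongrightarrow> 0) (at x)" by simp
  qed (use r Dbl in auto)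
  with Dbl DscC show ?thesis by (auto simp: bounded_clinear_def)
qed

text \<open>If the two sides differed, a support functional of their difference would separate them.
  It commutes with the integral, which exists by completeness, and so contradicts the scalar Cauchy
  formula for the derivative on the unit circle.\<close>

lemma Cauchy_formula_fderiv:
  fixes F :: "'a::complex_normed_vector \<Rightarrow> 'b::complex_banach"
  assumes F: "F holomorphic_map_on U" and U: "cball y (norm k) \<subseteq> U"
  shows "blinfun_apply (fderiv F y) k =
    integral {0..1} (\<lambda>t. exp (- (2 * of_real pi * \<i> * of_real t)) *\<^sub>C
                         F (y + exp (2 * of_real pi * \<i> * of_real t) *\<^sub>C k))"
    (is "?L = integral {0..1} ?f")
proof (rule ccontr)
  assume "?L \<noteq> integral {0..1} ?f"
  then obtain T where T: "T \<in> support_functionals (?L - integral {0..1} ?f)"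
    using support_functional_exists[of "?L - integral {0..1} ?f"] by auto
  then have bT: "bounded_clinear T" by (simp add: support_functionals_def)
  then interpret T: bounded_linear T by (simp add: bounded_clinear_def)
  have line: "y + z *\<^sub>C k \<in> U" if "cmod z \<le> 1" for z
    using U that by (auto simp: subset_iff mult_left_le_one_le)
  have cont: "continuous_on {0..1} ?f"
    by (intro continuous_intros continuous_on_compose2[OF holomorphic_map_on_continuous[OF F]])
       (use line in \<open>auto simp: norm_exp\<close>)
  let ?g = "\<lambda>z. T (F (y + z *\<^sub>C k))"
  have hol: "?g holomorphic_on cball 0 1"
    by (rule holomorphic_along_line[OF F _ bT]) (use line in auto)
  have "(?g has_field_derivative
      (1 / (2 * of_real pi * \<i>) * contour_integral (circlepath 0 1) (\<lambda>u. ?g u / (u - 0)\<^sup>2))) (at 0)"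
    by (rule Cauchy_derivative_integral_circlepath)
       (use hol in \<open>auto intro: holomorphic_on_imp_continuous_on holomorphic_on_subset\<close>)
  moreover have "(?g has_field_derivative T ?L) (at 0)"
    using field_derivative_along_line[OF F _ bT, of y 0 k] line[of 0] by simp
  ultimately have "T ?L = 1 / (2 * of_real pi * \<i>) * contour_integral (circlepath 0 1) (\<lambda>u. ?g u / (u - 0)\<^sup>2)"
    using DERIV_unique by blast
  also have "\<dots> = 1 / (2 * of_real pi * \<i>) * integral {0..1} (\<lambda>t. 2 * of_real pi * \<i> * T (?f t))"
  proof -
    have "contour_integral (circlepath 0 1) (\<lambda>u. ?g u / (u - 0)\<^sup>2) =
        integral {0..1} (\<lambda>t. 2 * of_real pi * \<i> * T (?f t))"
      unfolding contour_integral_integral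
    proof (rule integral_cong)
      fix t :: real
      let ?e = "exp (2 * of_real pi * \<i> * of_real t)"
      have vd: "vector_derivative (circlepath 0 1) (at t) = 2 * of_real pi * \<i> * ?e"
        using vector_derivative_circlepath[of 0 1 t] by (simp add: mult_ac)
      have "?e \<noteq> 0" by simp
      then show "T (F (y + circlepath 0 1 t *\<^sub>C k)) / (circlepath 0 1 t - 0)\<^sup>2 *
          vector_derivative (circlepath 0 1) (at t) = 2 * of_real pi * \<i> * T (?f t)"
        unfolding vd by (simp add: circlepath bounded_clinear_scaleC[OF bT]
            scaleC_complex_def exp_minus power2_eq_square field_simps)
    qed
    then show ?thesis by simp
  qed
  also have "\<dots> = T (integral {0..1} ?f)"
    using integral_linear[OF integrable_continuous_interval[OF cont] T.bounded_linear_axioms]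
    by (simp add: o_def)
  finally have "T (?L - integral {0..1} ?f) = 0" by (simp add: T.diff)
  with T \<open>?L \<noteq> integral {0..1} ?f\<close> show False by (simp add: support_functionals_def)
qed

text \<open>The Cauchy formula is differentiated under the integral sign. For norm k <= r and a base
  point within r of x the circle stays in the ball of radius 2 r; continuity of
  \<open>fderiv F\<close> there comes from \<open>fderiv_Lipschitz\<close> with 2 r in place of r,
  which accounts for the radius 6 r.\<close>

lemma fderiv_apply_holomorphic:
  fixes F :: "'a::complex_banach \<Rightarrow> 'b::complex_banach"
  assumes F: "F holomorphic_map_on U" and U: "cball x (6 * r) \<subseteq> U" and r: "r > 0"
    and M: "\<And>y. y \<in> cball x (6 * r) \<Longrightarrow> norm (F y) \<le> M" and k: "norm k \<le> r"
  shows "(\<lambda>y. blinfun_apply (fderiv F y) k) holomorphic_map_on ball x r"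
proof -
  define e where "e t = exp (2 * of_real pi * \<i> * of_real t)" for t
  define e' where "e' t = exp (- (2 * of_real pi * \<i> * of_real t))" for t
  have e: "cmod (e t) = 1" for t by (simp add: e_def norm_exp)
  have conte: "continuous_on S e" "continuous_on S e'" for S
    unfolding e_def e'_def by (auto intro!: continuous_intros)
  have in2: "y + e t *\<^sub>C k \<in> cball x (2 * r)" if "y \<in> ball x r" for y t
    using that k dist_triangle[of x "y + e t *\<^sub>C k" y] by (simp add: e)
  have sub: "cball x (2 * r) \<subseteq> U" using U r by (auto simp: subset_iff)
  have cont: "continuous_on (cball x (2 * r)) (fderiv F)"
  proof (rule lipschitz_on_continuous_on, rule lipschitz_onI)
    fix y z assume "y \<in> cball x (2 * r)" "z \<in> cball x (2 * r)"
    then show "dist (fderiv F y) (fderiv F z) \<le> M / (2 * r)\<^sup>2 * dist y z"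
      unfolding dist_norm by (intro fderiv_Lipschitz[OF F]) (use U M r in auto)
  next
    show "0 \<le> M / (2 * r)\<^sup>2"
      using order_trans[OF norm_ge_zero M[of x]] r by simp
  qed
  define I where "I y = integral {0..1} (\<lambda>t. e' t *\<^sub>C fderiv F (y + e t *\<^sub>C k))" for y
  have contD: "continuous_on (ball x r \<times> cbox 0 1) (\<lambda>(y, t). e' t *\<^sub>C fderiv F (y + e t *\<^sub>C k))"
    unfolding case_prod_beta
    by (intro continuous_intros continuous_on_compose2[OF cont] continuous_on_compose2[OF conte(1)[of UNIV]]
        continuous_on_compose2[OF conte(2)[of UNIV]]) (use in2 in auto)
  have der': "((\<lambda>y. integral (cbox 0 1) (\<lambda>t. e' t *\<^sub>C F (y + e t *\<^sub>C k))) has_derivative blinfun_apply (I z))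
      (at z within ball x r)" if z: "z \<in> ball x r" for z
    unfolding I_def box_real(2)[symmetric]
  proof (rule leibniz_rule)
    fix y and t :: real assume y: "y \<in> ball x r"
    have D: "((\<lambda>y. y + e t *\<^sub>C k) has_derivative (\<lambda>h. h)) (at y within ball x r)"
      by (auto intro!: derivative_eq_intros)
    have "((\<lambda>y. F (y + e t *\<^sub>C k)) has_derivative blinfun_apply (fderiv F (y + e t *\<^sub>C k)))
        (at y within ball x r)"
      by (rule has_derivative_compose[OF D has_derivative_fderiv[OF F]]) (use in2[OF y] sub in blast)
    from bounded_linear.has_derivative[OF bounded_linear_scaleC_right[of "e' t"] this]
    show "((\<lambda>y. e' t *\<^sub>C F (y + e t *\<^sub>C k)) has_derivative
        blinfun_apply (e' t *\<^sub>C fderiv F (y + e t *\<^sub>C k))) (at y within ball x r)"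
      unfolding blinfun_apply_scaleC[abs_def] .
  next
    fix y assume y: "y \<in> ball x r"
    show "(\<lambda>t. e' t *\<^sub>C F (y + e t *\<^sub>C k)) integrable_on cbox 0 1"
      by (intro integrable_continuous continuous_intros conte
          continuous_on_compose2[OF holomorphic_map_on_continuous[OF F]]) (use in2[OF y] sub in auto)
  qed (use contD z in auto)
  have der: "((\<lambda>y. integral (cbox 0 1) (\<lambda>t. e' t *\<^sub>C F (y + e t *\<^sub>C k))) has_derivative blinfun_apply (I z))
      (at z)" if z: "z \<in> ball x r" for z
    using der'[OF z] unfolding at_within_open[OF z open_ball] .
  have eq: "blinfun_apply (fderiv F y) k = integral (cbox 0 1) (\<lambda>t. e' t *\<^sub>C F (y + e t *\<^sub>C k))"
    if y: "y \<in> ball x r" for y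
    unfolding e_def e'_def box_real(2)
  proof (rule Cauchy_formula_fderiv[OF F])
    show "cball y (norm k) \<subseteq> U"
    proof
      fix z assume "z \<in> cball y (norm k)"
      then have "z \<in> cball x (2 * r)" using y k dist_triangle[of x z y] by simp
      then show "z \<in> U" using sub by blast
    qed
  qed
  show ?thesis
  proof (rule holomorphic_map_onI)
    fix z assume z: "z \<in> ball x r"
    show "((\<lambda>y. blinfun_apply (fderiv F y) k) has_derivative blinfun_apply (I z)) (at z)"
      by (rule has_derivative_transform_within_open[OF der[OF z] open_ball z]) (simp add: eq)
    fix c h
    have int: "(\<lambda>t. e' t *\<^sub>C fderiv F (z + e t *\<^sub>C k)) integrable_on {0..1}"
      by (intro integrable_continuous_interval continuous_intros conte continuous_on_compose2[OF cont])
         (use in2[OF z] in auto)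
    have app: "blinfun_apply (I z) h = integral {0..1} (\<lambda>t. e' t *\<^sub>C blinfun_apply (fderiv F (z + e t *\<^sub>C k)) h)"
      for h
      using integral_linear[OF int blinfun.bounded_linear_left[of h]]
      by (simp add: I_def o_def blinfun_apply_scaleC)
    have inth: "(\<lambda>t. e' t *\<^sub>C blinfun_apply (fderiv F (z + e t *\<^sub>C k)) h) integrable_on {0..1}"
      using integrable_linear[OF int blinfun.bounded_linear_left[of h]]
      by (simp add: o_def blinfun_apply_scaleC)
    have "blinfun_apply (I z) (c *\<^sub>C h) =
        integral {0..1} (\<lambda>t. c *\<^sub>C e' t *\<^sub>C blinfun_apply (fderiv F (z + e t *\<^sub>C k)) h)"
      unfolding app
    proof (rule integral_cong)
      fix t
      have "z + e t *\<^sub>C k \<in> U" using in2[OF z] sub by blast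
      then show "e' t *\<^sub>C blinfun_apply (fderiv F (z + e t *\<^sub>C k)) (c *\<^sub>C h) =
          c *\<^sub>C e' t *\<^sub>C blinfun_apply (fderiv F (z + e t *\<^sub>C k)) h"
        by (simp add: fderiv_scaleC[OF F] scaleC_scaleC mult.commute)
    qed
    also have "\<dots> = c *\<^sub>C blinfun_apply (I z) h"
      using integral_linear[OF inth bounded_linear_scaleC_right[of c]] by (simp add: o_def app)
    finally show "blinfun_apply (I z) (c *\<^sub>C h) = c *\<^sub>C blinfun_apply (I z) h" .
  qed
qed

text \<open>Evaluations are holomorphic by the Cauchy formula, local boundedness is a Cauchy
  estimate, and together they give holomorphy in operator norm. Since the conclusion has the form of
  the hypothesis, all higher derivatives exist.\<close>

theorem fderiv_holomorphic:
  fixes F :: "'a::complex_banach \<Rightarrow> 'b::complex_banach"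
  assumes F: "F holomorphic_map_on U" and U: "open U"
  shows "fderiv F holomorphic_map_on U"
  unfolding holomorphic_map_on_def
proof
  fix x assume "x \<in> U"
  from locally_bounded_ball[OF F U this] obtain R M
    where R: "R > 0" "cball x R \<subseteq> U" "\<And>y. y \<in> cball x R \<Longrightarrow> norm (F y) \<le> M" by blast
  define r where "r = R / 6"
  have r: "r > 0" "cball x (6 * r) \<subseteq> U" "\<And>y. y \<in> cball x (6 * r) \<Longrightarrow> norm (F y) \<le> M"
    using R by (auto simp: r_def)
  show "\<exists>D. bounded_clinear D \<and> (fderiv F has_derivative D) (at x)"
  proof (rule norm_holomorphic_if_pointwise[OF _ r(1)])
    fix y assume y: "y \<in> ball x r"
    show "norm (fderiv F y) \<le> M / r"
    proof (rule fderiv_norm_le[OF F _ r(1)])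
      have *: "z \<in> cball x (6 * r)" if "z \<in> cball y r" for z
        using that y r dist_triangle[of x z y] by simp
      show "cball y r \<subseteq> U" using * r by blast
      show "norm (F z) \<le> M" if "z \<in> cball y r" for z using * that r(3) by blast
    qed
  next
    fix k :: 'a
    \<comment> \<open>Evaluation at an arbitrary k is s times evaluation at a vector of norm at most
      r; the summand 1 keeps s positive for k = 0.\<close>
    define s where "s = norm k / r + 1"
    have s: "s > 0" using r by (simp add: s_def add_nonneg_pos)
    have "norm k \<le> s * r" using r by (simp add: s_def field_simps)
    then have "norm (inverse s *\<^sub>R k) \<le> r" using s by (simp add: field_simps)
    then have h: "(\<lambda>y. blinfun_apply (fderiv F y) (inverse s *\<^sub>R k)) holomorphic_map_on ball x r"
      by (intro fderiv_apply_holomorphic[OF F r(2,1,3)])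
    show "(\<lambda>y. blinfun_apply (fderiv F y) k) holomorphic_map_on ball x r"
    proof (rule holomorphic_map_onI)
      fix y assume y: "y \<in> ball x r"
      from has_derivative_scaleR_right[OF has_derivative_fderiv[OF h y], of s] s
      show "((\<lambda>y. blinfun_apply (fderiv F y) k) has_derivative
          (\<lambda>d. s *\<^sub>R blinfun_apply (fderiv (\<lambda>y. blinfun_apply (fderiv F y) (inverse s *\<^sub>R k)) y) d)) (at y)"
        by (simp add: blinfun.scaleR_right)
    qed (simp add: fderiv_scaleC[OF h] scaleR_scaleC)
  qed
qed

subsection \<open>Schur coefficients\<close>

lemma bounded_holomorphic_constant_or_less:
  assumes hol: "f holomorphic_on ball 0 1" and le: "\<And>z. norm z < 1 \<Longrightarrow> norm (f z) \<le> 1"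
    and nc: "\<not> f constant_on ball 0 1" and z: "norm z < 1"
  shows "norm (f z) < 1"
proof (rule ccontr)
  assume "\<not> norm (f z) < 1"
  then have max: "norm (f w) \<le> norm (f z)" if "w \<in> ball 0 1" for w
    using le[of w] that by auto
  have "f constant_on ball 0 1"
    by (rule maximum_modulus_principle[OF hol, of "ball 0 1" z]) (use max z in auto)
  with nc show False ..
qed

text \<open>One step of the Schur algorithm, with t = (s - s 0) / (z (1 - cnj (s 0) s)). The
  relation is kept free of denominators so that it also covers constant s, where |s 0| may be 1 and
  t = 0 is taken.\<close>

lemma Schur_step:
  assumes hol: "s holomorphic_on ball 0 1" and le: "\<And>z. norm z < 1 \<Longrightarrow> norm (s z) \<le> 1"
  obtains t where "t holomorphic_on ball 0 1" "\<And>z. norm z < 1 \<Longrightarrow> norm (t z) \<le> 1"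
    "\<And>z. norm z < 1 \<Longrightarrow> s z * (1 + cnj (s 0) * (z * t z)) = s 0 + z * t z"
proof (cases "s constant_on ball 0 1")
  case True
  then obtain c where "\<And>z. z \<in> ball 0 1 \<Longrightarrow> s z = c" unfolding constant_on_def by blast
  then show ?thesis by (intro that[of "\<lambda>_. 0"]) auto
next
  case False
  define a where "a = s 0"
  have lt: "norm (s z) < 1" if "norm z < 1" for z
    using bounded_holomorphic_constant_or_less[OF hol le False that] .
  have a: "norm a < 1" using lt[of 0] by (simp add: a_def)
  have nz: "1 - cnj a * s z \<noteq> 0" if "norm z < 1" for z
  proof
    assume "1 - cnj a * s z = 0"
    then have "norm (cnj a * s z) = 1" by simp
    moreover have "norm a * norm (s z) < 1 * 1"
      by (rule mult_strict_mono') (use a lt[OF that] in auto)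
    ultimately show False by (simp add: norm_mult)
  qed
  define m where "m z = (s z - a) / (1 - cnj a * s z)" for z
  have m_hol: "m holomorphic_on ball 0 1"
    unfolding m_def by (intro holomorphic_intros hol) (use nz in auto)
  have m0: "m 0 = 0" by (simp add: m_def a_def)
  have m_lt: "norm (m z) < 1" if "norm z < 1" for z
  proof -
    have "(norm (1 - cnj a * s z))\<^sup>2 - (norm (s z - a))\<^sup>2 = (1 - (norm a)\<^sup>2) * (1 - (norm (s z))\<^sup>2)"
      by (simp only: cmod_power2) (simp, algebra)
    moreover have "(1 - (norm a)\<^sup>2) * (1 - (norm (s z))\<^sup>2) > 0"
      using a lt[OF that] by (simp add: abs_square_less_1)
    ultimately have "(norm (s z - a))\<^sup>2 < (norm (1 - cnj a * s z))\<^sup>2" by simp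
    then have "norm (s z - a) < norm (1 - cnj a * s z)" by (rule power2_less_imp_less) simp
    then show ?thesis using nz[OF that] by (simp add: m_def norm_divide)
  qed
  obtain t where t: "t holomorphic_on ball 0 1" "\<And>z. norm z < 1 \<Longrightarrow> m z = z * t z" "deriv m 0 = t 0"
    using Schwarz3[OF m_hol m0] by blast
  show ?thesis
  proof (rule that[OF t(1)])
    fix z :: complex assume z: "norm z < 1"
    show "norm (t z) \<le> 1"
    proof (cases "z = 0")
      case True
      then show ?thesis using Schwarz_Lemma(2)[OF m_hol m0 m_lt, of 0] t(3) by simp
    next
      case nz: False
      have "norm (m z) \<le> norm z" using Schwarz_Lemma(1)[OF m_hol m0 m_lt z] .
      then show ?thesis using nz t(2)[OF z] by (simp add: norm_mult)
    qed
    have "z * t z * (1 - cnj a * s z) = s z - a"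
      using t(2)[OF z] by (simp only: m_def nonzero_divide_eq_eq[OF nz[OF z]])
    then show "s z * (1 + cnj (s 0) * (z * t z)) = s 0 + z * t z"
      unfolding a_def by algebra
  qed
qed

lemma has_fps_expansion_disc:
  "f holomorphic_on ball 0 1 \<Longrightarrow> f has_fps_expansion fps_expansion f 0"
  by (rule has_fps_expansion_fps_expansion[of "ball 0 1"]) auto

lemma fps_expansion_0: "f holomorphic_on ball 0 1 \<Longrightarrow> fps_nth (fps_expansion f 0) 0 = f 0"
  using fps_nth_fps_expansion[OF has_fps_expansion_disc, of f 0] by simp

lemma fps_eq_on_disc:
  fixes f g :: "complex \<Rightarrow> complex"
  assumes "f has_fps_expansion F" "g has_fps_expansion G" "\<And>z. norm z < 1 \<Longrightarrow> f z = g z"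
  shows "F = G"
proof -
  have "eventually (\<lambda>z. z \<in> ball 0 1) (nhds (0::complex))"
    by (rule eventually_nhds_in_open) auto
  then have "eventually (\<lambda>z. f z = g z) (nhds 0)"
    by (rule eventually_mono) (use assms(3) in auto)
  then have "g has_fps_expansion F" using assms(1) has_fps_expansion_cong by blast
  then show ?thesis using assms(2) fps_expansion_eqI by metis
qed

text \<open>Coefficients of z and z^2 in the relation of \<open>Schur_step\<close>. They are
  expressed through the next Schur function t, to which the lemma can be applied in turn.\<close>

lemma Schur_coefficients:
  assumes hol: "s holomorphic_on ball 0 1" and le: "\<And>z. norm z < 1 \<Longrightarrow> norm (s z) \<le> 1"
  obtains t where "t holomorphic_on ball 0 1" "\<And>z. norm z < 1 \<Longrightarrow> norm (t z) \<le> 1"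
    "fps_nth (fps_expansion s 0) 1 = (1 - s 0 * cnj (s 0)) * t 0"
    "fps_nth (fps_expansion s 0) 2 =
      (1 - s 0 * cnj (s 0)) * (fps_nth (fps_expansion t 0) 1 - cnj (s 0) * (t 0)\<^sup>2)"
proof -
  obtain t where t: "t holomorphic_on ball 0 1" "\<And>z. norm z < 1 \<Longrightarrow> norm (t z) \<le> 1"
    "\<And>z. norm z < 1 \<Longrightarrow> s z * (1 + cnj (s 0) * (z * t z)) = s 0 + z * t z"
    using Schur_step[OF hol le] by blast
  define S T where "S = fps_expansion s 0" and "T = fps_expansion t 0"
  have exps: "s has_fps_expansion S" "t has_fps_expansion T"
    unfolding S_def T_def by (intro has_fps_expansion_disc hol t)+
  have S0: "fps_nth S 0 = s 0" and T0: "fps_nth T 0 = t 0"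
    unfolding S_def T_def by (intro fps_expansion_0 hol t)+
  have "S * (1 + fps_const (cnj (s 0)) * (fps_X * T)) = fps_const (s 0) + fps_X * T"
    by (rule fps_eq_on_disc[OF _ _ t(3)]) (auto intro!: fps_expansion_intros exps)
  then have eq: "fps_nth (S * (1 + fps_const (cnj (s 0)) * (fps_X * T))) n
      = fps_nth (fps_const (s 0) + fps_X * T) n" for n by simp
  have 1: "fps_nth S 1 = (1 - s 0 * cnj (s 0)) * t 0"
    using eq[of 1] by (simp add: fps_mult_nth S0 T0 algebra_simps)
  have "fps_nth S 2 + (s 0 * (cnj (s 0) * fps_nth T 1) + t 0 * (cnj (s 0) * fps_nth S 1)) = fps_nth T 1"
    using eq[of 2] by (simp add: fps_mult_nth S0 T0 numeral_2_eq_2 algebra_simps)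
  then have "fps_nth S 2 = fps_nth T 1 - (s 0 * (cnj (s 0) * fps_nth T 1) + t 0 * (cnj (s 0) * fps_nth S 1))"
    by (simp only: eq_diff_eq)
  then have "fps_nth S 2 = (1 - s 0 * cnj (s 0)) * (fps_nth T 1 - cnj (s 0) * (t 0)\<^sup>2)"
    unfolding 1 by (simp add: power2_eq_square algebra_simps)
  with 1 t show ?thesis by (intro that[of t]) (auto simp: S_def T_def)
qed

section \<open>The inequality for the Schur coefficients and its transfer to g\<close>

text \<open>Inserting the bound for Y leaves a function of X that is nondecreasing on [0, 1],
  because (1 - a)(3 - a) >= 0. At X = 1 it equals 1 + a^2, and (1 - a^2)(1 + a^2) + a^4 = 1.\<close>

lemma Schur_bound_real:
  fixes a X Y :: real
  assumes a: "0 \<le> a" "a \<le> 1" and X: "0 \<le> X" "X \<le> 1" and Y: "Y \<le> 1 - X\<^sup>2"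
  shows "(1 - a\<^sup>2) * (4/3 * a * Y + (1 + a\<^sup>2/3) * X\<^sup>2 + 2/3 * a\<^sup>2 * X) + a ^ 4 \<le> 1"
proof -
  have "4/3 * a * Y \<le> 4/3 * a * (1 - X\<^sup>2)" using a Y by (intro mult_left_mono) auto
  moreover have "4/3 * a * (1 - X\<^sup>2) + (1 + a\<^sup>2/3) * X\<^sup>2 = 4/3 * a + (1 - a) * (3 - a) / 3 * X\<^sup>2"
    by (simp add: field_simps power2_eq_square)
  ultimately have "4/3 * a * Y + (1 + a\<^sup>2/3) * X\<^sup>2 + 2/3 * a\<^sup>2 * X
      \<le> 4/3 * a + (1 - a) * (3 - a) / 3 * X\<^sup>2 + 2/3 * a\<^sup>2 * X"
    by linarith
  also have "\<dots> \<le> 4/3 * a + (1 - a) * (3 - a) / 3 * 1 + 2/3 * a\<^sup>2 * 1"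
    using a X by (intro add_mono mult_left_mono order_refl) (auto simp: power_le_one)
  also have "\<dots> = 1 + a\<^sup>2" by (simp add: field_simps power2_eq_square)
  finally have "(1 - a\<^sup>2) * (4/3 * a * Y + (1 + a\<^sup>2/3) * X\<^sup>2 + 2/3 * a\<^sup>2 * X) \<le> (1 - a\<^sup>2) * (1 + a\<^sup>2)"
    using a by (intro mult_left_mono) (auto simp: power_le_one)
  then show ?thesis by (simp add: algebra_simps power2_eq_square power4_eq_xxxx)
qed

text \<open>Here w is the value at 0 of a Schur function s, while x and y are the first two
  coefficients of the next one; \<open>w2\<close> and \<open>w3\<close> are then the further
  coefficients of s. Once 1 - |w|^2 is factored out, the triangle inequality and |1 + 2 \<gamma>| <=
  3 lead to the expression of \<open>Schur_bound_real\<close> with a = |w|.\<close>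

lemma Schur_bound:
  fixes w x y \<gamma> :: complex
  assumes w: "cmod w \<le> 1" and x: "cmod x \<le> 1" and y: "cmod y \<le> 1 - (cmod x)\<^sup>2" and \<gamma>: "cmod \<gamma> = 1"
    and w2: "w2 = (1 - w * cnj w) * x" and w3: "w3 = (1 - w * cnj w) * (y - cnj w * x\<^sup>2)"
  shows "cmod (4/3 * w * w3 - w2\<^sup>2 - 2/3 * \<gamma> * w\<^sup>2 * w2 - 1/3 * (1 + 2 * \<gamma>) * w ^ 4) \<le> 1"
proof -
  define a where "a = cmod w"
  have ww: "w * cnj w = of_real (a\<^sup>2)" by (simp only: a_def complex_norm_square)
  have eq: "4/3 * w * w3 - w2\<^sup>2 - 2/3 * \<gamma> * w\<^sup>2 * w2 - 1/3 * (1 + 2 * \<gamma>) * w ^ 4 =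
      of_real (1 - a\<^sup>2) * (4/3 * w * y - of_real (1 + a\<^sup>2 / 3) * x\<^sup>2 - 2/3 * \<gamma> * w\<^sup>2 * x)
      - 1/3 * (1 + 2 * \<gamma>) * w ^ 4" (is "?L = ?R")
  proof -
    have "?L = (1 - w * cnj w) * (4/3 * w * y - (1 + w * cnj w / 3) * x\<^sup>2 - 2/3 * \<gamma> * w\<^sup>2 * x)
      - 1/3 * (1 + 2 * \<gamma>) * w ^ 4"
      unfolding w2 w3 by (simp add: field_simps power2_eq_square power4_eq_xxxx)
    also have "\<dots> = ?R" unfolding ww by simp
    finally show ?thesis .
  qed
  have "cmod (of_real (1 - a\<^sup>2) * (4/3 * w * y - of_real (1 + a\<^sup>2 / 3) * x\<^sup>2 - 2/3 * \<gamma> * w\<^sup>2 * x)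
      - 1/3 * (1 + 2 * \<gamma>) * w ^ 4) \<le> (1 - a\<^sup>2) * (4/3 * a * cmod y + (1 + a\<^sup>2/3) * (cmod x)\<^sup>2 + 2/3 * a\<^sup>2 * cmod x) + a ^ 4"
  proof (rule order_trans[OF norm_triangle_ineq4 add_mono])
    have a1: "1 - a\<^sup>2 \<ge> 0" using w by (simp add: a_def power_le_one)
    have "cmod (4/3 * w * y - of_real (1 + a\<^sup>2 / 3) * x\<^sup>2 - 2/3 * \<gamma> * w\<^sup>2 * x)
      \<le> cmod (4/3 * w * y) + cmod (of_real (1 + a\<^sup>2 / 3) * x\<^sup>2) + cmod (2/3 * \<gamma> * w\<^sup>2 * x)"
      by (intro order_trans[OF norm_triangle_ineq4] add_mono norm_triangle_ineq4 order_refl)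
    also have "\<dots> = 4/3 * a * cmod y + (1 + a\<^sup>2/3) * (cmod x)\<^sup>2 + 2/3 * a\<^sup>2 * cmod x"
    proof -
      have "cmod (of_real (1 + a\<^sup>2 / 3)) = 1 + a\<^sup>2 / 3" unfolding norm_of_real by simp
      then show ?thesis using \<gamma> by (simp only: norm_mult norm_power a_def[symmetric]) simp
    qed
    finally show "cmod (of_real (1 - a\<^sup>2) * (4/3 * w * y - of_real (1 + a\<^sup>2 / 3) * x\<^sup>2 - 2/3 * \<gamma> * w\<^sup>2 * x))
      \<le> (1 - a\<^sup>2) * (4/3 * a * cmod y + (1 + a\<^sup>2/3) * (cmod x)\<^sup>2 + 2/3 * a\<^sup>2 * cmod x)"
      unfolding norm_mult norm_of_real abs_of_nonneg[OF a1] by (rule mult_left_mono[OF _ a1])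
    have "cmod (1 + 2 * \<gamma>) \<le> 3" using norm_triangle_ineq[of 1 "2 * \<gamma>"] \<gamma> by (simp add: norm_mult)
    then have "cmod (1 + 2 * \<gamma>) * a ^ 4 \<le> 3 * a ^ 4" by (rule mult_right_mono) (simp add: a_def)
    then show "cmod (1/3 * (1 + 2 * \<gamma>) * w ^ 4) \<le> a ^ 4"
      by (simp add: norm_mult norm_power a_def norm_divide)
  qed
  also have "\<dots> \<le> 1" using w x y by (intro Schur_bound_real) (auto simp: a_def)
  finally show ?thesis unfolding eq .
qed

text \<open>With e = e^(i \<beta>), the Cayley transform of \<open>cnj e * g\<close> that sends the
  value \<open>cnj e\<close> to 0 has the form z s with |s| <= 1. Clearing denominators gives g - 1
  = z s (g + \<gamma>), a recursion for the coefficients of g in terms of those of s.\<close>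

lemma spirallike_coefficient_bound:
  fixes g :: "complex \<Rightarrow> complex"
  assumes hol: "g holomorphic_on ball 0 1" and g0: "g 0 = 1"
    and pos: "\<And>z. norm z < 1 \<Longrightarrow> Re (exp (- (\<i> * of_real \<beta>)) * g z) > 0"
  defines "c \<equiv> fps_nth (fps_expansion g 0)"
  shows "cmod (c 1 * c 3 / 3 - (c 2)\<^sup>2 / 4 - (c 1)\<^sup>2 * c 2 / 6) \<le> (cos \<beta>)\<^sup>2"
proof -
  define e where "e = exp (\<i> * of_real \<beta>)"
  have e: "cmod e = 1" "e \<noteq> 0" by (auto simp: e_def norm_exp)
  have e': "exp (- (\<i> * of_real \<beta>)) = cnj e" "cnj e * e = 1"
    by (auto simp: e_def exp_cnj exp_add[symmetric])
  define \<gamma> where "\<gamma> = e\<^sup>2"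
  have \<gamma>: "cmod \<gamma> = 1" by (simp add: \<gamma>_def norm_power e)
  have pos': "Re (cnj e * g z) > 0" if "norm z < 1" for z using pos[OF that] by (simp add: e')
  \<comment> \<open>The points \<open>cnj e\<close> and \<open>- e\<close> are mirror images in the
    imaginary axis, and \<open>cnj e\<close> lies to its right since g 0 = 1; so points of the right
    half-plane are closer to \<open>cnj e\<close>.\<close>
  have less: "cmod (cnj e * (g z - 1)) < cmod (cnj e * g z + e)" if z: "norm z < 1" for z
  proof -
    have "Re e > 0" using pos'[of 0] g0 by simp
    then have "0 < 4 * Re (cnj e * g z) * Re e" using pos'[OF z] by simp
    also have "\<dots> = (cmod (cnj e * g z + e))\<^sup>2 - (cmod (cnj e * g z - cnj e))\<^sup>2"
      by (simp only: cmod_power2) (simp add: power2_eq_square algebra_simps)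
    finally have "(cmod (cnj e * g z - cnj e))\<^sup>2 < (cmod (cnj e * g z + e))\<^sup>2" by simp
    then show ?thesis unfolding right_diff_distrib mult_1_right by (rule power2_less_imp_less) simp
  qed
  define f where "f z = cnj e * (g z - 1) / (cnj e * g z + e)" for z
  have nz: "cnj e * g z + e \<noteq> 0" if "norm z < 1" for z using less[OF that] by auto
  have f: "f holomorphic_on ball 0 1"
    unfolding f_def by (intro holomorphic_intros hol) (use nz in auto)
  have f0: "f 0 = 0" by (simp add: f_def g0)
  have f1: "norm (f z) < 1" if "norm z < 1" for z
    using less[OF that] by (simp add: f_def norm_divide divide_less_eq)
  obtain s where s: "s holomorphic_on ball 0 1" "\<And>z. norm z < 1 \<Longrightarrow> f z = z * s z" "deriv f 0 = s 0"
    using Schwarz3[OF f f0] by blast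
  have s1: "norm (s z) \<le> 1" if z: "norm z < 1" for z
  proof (cases "z = 0")
    case True
    then show ?thesis using Schwarz_Lemma(2)[OF f f0 f1, of 0] s(3) by simp
  next
    case nz: False
    have "norm (f z) \<le> norm z" using Schwarz_Lemma(1)[OF f f0 f1 z] .
    then show ?thesis using nz s(2)[OF z] by (simp add: norm_mult)
  qed
  have eq: "g z - 1 = z * s z * (g z + \<gamma>)" if z: "norm z < 1" for z
  proof -
    have "cnj e * (g z - 1) = z * s z * (cnj e * g z + e)"
      using s(2)[OF z] nz[OF z] by (simp only: f_def nonzero_divide_eq_eq[OF nz[OF z]])
    then have "e * (cnj e * (g z - 1)) = e * (z * s z * (cnj e * g z + e))" by (simp only:)
    moreover have "e * (cnj e * (g z - 1)) = (cnj e * e) * (g z - 1)" by (simp only: mult_ac)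
    moreover have "e * (z * s z * (cnj e * g z + e)) = z * s z * ((cnj e * e) * g z + e\<^sup>2)"
      by (simp add: power2_eq_square algebra_simps)
    ultimately have "(cnj e * e) * (g z - 1) = z * s z * ((cnj e * e) * g z + e\<^sup>2)"
      by (simp only:)
    then show ?thesis by (simp add: e' \<gamma>_def)
  qed
  define S G where "S = fps_expansion s 0" and "G = fps_expansion g 0"
  have exps: "s has_fps_expansion S" "g has_fps_expansion G"
    unfolding S_def G_def by (intro has_fps_expansion_disc hol s)+
  have G0: "fps_nth G 0 = 1" unfolding G_def using fps_expansion_0[OF hol] g0 by simp
  have S0: "fps_nth S 0 = s 0" unfolding S_def by (rule fps_expansion_0[OF s(1)])
  have "G - 1 = fps_X * S * (G + fps_const \<gamma>)"
    by (rule fps_eq_on_disc[OF _ _ eq]) (auto intro!: fps_expansion_intros exps)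
  then have eqn: "fps_nth (G - 1) n = fps_nth (fps_X * (S * (G + fps_const \<gamma>))) n" for n
    by (simp add: mult.assoc)
  define w2 w3 where "w2 = fps_nth S 1" and "w3 = fps_nth S 2"
  \<comment> \<open>The factor 1 + \<gamma> is the constant coefficient of G + \<gamma>; through the
    recursion it passes on to \<open>c 2\<close> and \<open>c 3\<close>.\<close>
  have c1: "c 1 = (1 + \<gamma>) * s 0"
    using eqn[of 1] by (simp add: c_def G_def[symmetric] fps_mult_nth G0 S0 algebra_simps)
  have c2: "c 2 = (1 + \<gamma>) * w2 + s 0 * c 1"
    using eqn[of 2] by (simp add: c_def G_def[symmetric] w2_def fps_mult_nth G0 S0 algebra_simps numeral_2_eq_2)
  have c3: "c 3 = (1 + \<gamma>) * w3 + w2 * c 1 + s 0 * c 2"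
    using eqn[of 3] by (simp add: c_def G_def[symmetric] w2_def w3_def fps_mult_nth G0 S0
        algebra_simps numeral_2_eq_2 numeral_3_eq_3)
  obtain t where t: "t holomorphic_on ball 0 1" "\<And>z. norm z < 1 \<Longrightarrow> norm (t z) \<le> 1"
    "w2 = (1 - s 0 * cnj (s 0)) * t 0"
    "w3 = (1 - s 0 * cnj (s 0)) * (fps_nth (fps_expansion t 0) 1 - cnj (s 0) * (t 0)\<^sup>2)"
    using Schur_coefficients[OF s(1) s1] unfolding w2_def w3_def S_def by blast
  \<comment> \<open>The Schwarz-Pick inequality at 0, read off from one more Schur step.\<close>
  have t1: "cmod (fps_nth (fps_expansion t 0) 1) \<le> 1 - (cmod (t 0))\<^sup>2"
  proof -
    obtain u where "u holomorphic_on ball 0 1" and u: "\<And>z. norm z < 1 \<Longrightarrow> norm (u z) \<le> 1"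
      "fps_nth (fps_expansion t 0) 1 = (1 - t 0 * cnj (t 0)) * u 0"
      "fps_nth (fps_expansion t 0) 2 =
        (1 - t 0 * cnj (t 0)) * (fps_nth (fps_expansion u 0) 1 - cnj (t 0) * (u 0)\<^sup>2)"
      using Schur_coefficients[OF t(1,2)] by blast
    have n: "1 - t 0 * cnj (t 0) = of_real (1 - (cmod (t 0))\<^sup>2)"
      by (simp only: complex_norm_square of_real_diff of_real_1)
    have "0 \<le> 1 - (cmod (t 0))\<^sup>2" using t(2)[of 0] by (simp add: power_le_one)
    then show ?thesis
      unfolding u(2) n norm_mult norm_of_real using u(1)[of 0] by (simp add: mult_left_le)
  qed
  have eqc: "c 1 * c 3 / 3 - (c 2)\<^sup>2 / 4 - (c 1)\<^sup>2 * c 2 / 6 = ((1 + \<gamma>) / 2)\<^sup>2 *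
      (4/3 * s 0 * w3 - w2\<^sup>2 - 2/3 * \<gamma> * (s 0)\<^sup>2 * w2 - 1/3 * (1 + 2 * \<gamma>) * (s 0) ^ 4)"
    unfolding c3 c2 c1 by (simp add: field_simps power2_eq_square power4_eq_xxxx)
  have "cmod (c 1 * c 3 / 3 - (c 2)\<^sup>2 / 4 - (c 1)\<^sup>2 * c 2 / 6) \<le> (cmod ((1 + \<gamma>) / 2))\<^sup>2 * 1"
    unfolding eqc norm_mult[of "((1 + \<gamma>) / 2)\<^sup>2"] norm_power[of "(1 + \<gamma>) / 2"]
    by (intro mult_left_mono Schur_bound[OF _ _ t1 \<gamma> t(3,4)]) (use s1[of 0] t(2)[of 0] in auto)
  also have "(cmod ((1 + \<gamma>) / 2))\<^sup>2 * 1 = (cos \<beta>)\<^sup>2"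
  proof -
    have "1 + \<gamma> = e * (cnj e + e)" using e' by (simp add: \<gamma>_def power2_eq_square algebra_simps)
    also have "cnj e + e = of_real (2 * cos \<beta>)"
      by (simp add: e_def complex_eq_iff Re_exp Im_exp)
    finally show ?thesis by (simp add: norm_mult norm_divide e power_divide power_mult_distrib)
  qed
  finally show ?thesis .
qed

subsection \<open>Expansion along a complex line\<close>

text \<open>Big-O at 0 for vector-valued functions. Because of \<open>nhds\<close> the bound
  includes z = 0, so r 0 = 0 is forced when n > 0.\<close>

definition vanishes_to_order :: "nat \<Rightarrow> (complex \<Rightarrow> 'a::real_normed_vector) \<Rightarrow> bool"
  where "vanishes_to_order n r \<longleftrightarrow>
    (\<exists>C. \<forall>\<^sub>F z in nhds 0. norm (r z) \<le> C * cmod z ^ n)"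

lemma vanishes_to_orderI:
  "(\<And>z. norm (r z) \<le> C * cmod z ^ n) \<Longrightarrow> vanishes_to_order n r"
  unfolding vanishes_to_order_def by (auto intro!: exI[of _ C])

lemma vanishes_to_order_add:
  assumes "vanishes_to_order n r" "vanishes_to_order n s"
  shows "vanishes_to_order n (\<lambda>z. r z + s z)"
proof -
  from assms obtain C D where ev: "\<forall>\<^sub>F z in nhds 0. norm (r z) \<le> C * cmod z ^ n"
    "\<forall>\<^sub>F z in nhds 0. norm (s z) \<le> D * cmod z ^ n"
    unfolding vanishes_to_order_def by blast
  have "\<forall>\<^sub>F z in nhds 0. norm (r z + s z) \<le> (C + D) * cmod z ^ n"
    using ev
  proof eventually_elim
    case (elim z)
    then show ?case using norm_triangle_ineq[of "r z" "s z"] by (simp add: distrib_right)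
  qed
  then show ?thesis unfolding vanishes_to_order_def by blast
qed

lemma vanishes_to_order_dominated:
  assumes "vanishes_to_order n r" "\<forall>\<^sub>F z in nhds 0. norm (s z) \<le> K * norm (r z)" "K \<ge> 0"
  shows "vanishes_to_order n s"
proof -
  from assms obtain C where ev: "\<forall>\<^sub>F z in nhds 0. norm (r z) \<le> C * cmod z ^ n"
    unfolding vanishes_to_order_def by blast
  have "\<forall>\<^sub>F z in nhds 0. norm (s z) \<le> (K * C) * cmod z ^ n"
    using ev assms(2)
  proof eventually_elim
    case (elim z)
    then show ?case using mult_left_mono[OF elim(1) assms(3)] by (simp add: mult.assoc)
  qed
  then show ?thesis unfolding vanishes_to_order_def by blast
qed

lemma vanishes_to_order_minus: "vanishes_to_order n r \<Longrightarrow> vanishes_to_order n (\<lambda>z. - r z)"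
  by (simp add: vanishes_to_order_def)

lemma vanishes_to_order_diff:
  "vanishes_to_order n r \<Longrightarrow> vanishes_to_order n s \<Longrightarrow> vanishes_to_order n (\<lambda>z. r z - s z)"
  using vanishes_to_order_add[OF _ vanishes_to_order_minus, of n r s] by simp

lemma vanishes_to_order_scaleC:
  fixes r :: "complex \<Rightarrow> 'a::complex_normed_vector"
  assumes "vanishes_to_order m p" "vanishes_to_order n r"
  shows "vanishes_to_order (m + n) (\<lambda>z. p z *\<^sub>C r z)"
proof -
  from assms obtain C D where ev: "\<forall>\<^sub>F z in nhds 0. norm (p z) \<le> C * cmod z ^ m"
    "\<forall>\<^sub>F z in nhds 0. norm (r z) \<le> D * cmod z ^ n"
    unfolding vanishes_to_order_def by blast
  have "\<forall>\<^sub>F z in nhds 0. norm (p z *\<^sub>C r z) \<le> (C * D) * cmod z ^ (m + n)"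
    using ev
  proof eventually_elim
    case (elim z)
    have "norm (p z) * norm (r z) \<le> (C * cmod z ^ m) * (D * cmod z ^ n)"
      by (rule mult_mono[OF elim]) (use order_trans[OF norm_ge_zero elim(1)] in auto)
    then show ?case by (simp add: norm_scaleC power_add mult_ac)
  qed
  then show ?thesis unfolding vanishes_to_order_def by blast
qed

lemma vanishes_to_order_isCont:
  assumes "isCont p 0"
  shows "vanishes_to_order 0 p"
proof -
  obtain d where d: "d > 0" "\<And>z. dist z 0 < d \<Longrightarrow> dist (p z) (p 0) < 1"
    using assms unfolding continuous_at_eps_delta by (metis zero_less_one)
  have "\<forall>\<^sub>F z in nhds 0. norm (p z) \<le> (norm (p 0) + 1) * cmod z ^ 0"
    unfolding eventually_nhds_metric
  proof (intro exI[of _ d] conjI allI impI)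
    fix z :: complex assume "dist z 0 < d"
    then show "norm (p z) \<le> (norm (p 0) + 1) * cmod z ^ 0"
      using d(2)[of z] norm_triangle_ineq2[of "p z" "p 0"] by (simp add: dist_norm)
  qed (use d in auto)
  then show ?thesis unfolding vanishes_to_order_def by blast
qed

lemma vanishes_to_order_derivative:
  assumes "(f has_derivative D) (at 0)"
  shows "vanishes_to_order 1 (\<lambda>z. f z - f 0)"
proof -
  interpret D: bounded_linear D using assms by (rule has_derivative_bounded_linear)
  have "((\<lambda>z. norm (f z - f 0 - D (z - 0)) / norm (z - 0)) \<longlongrightarrow> 0) (at 0)"
    using assms unfolding has_derivative_iff_norm by blast
  from order_tendstoD(2)[OF this zero_less_one]
  have "\<forall>\<^sub>F z in nhds 0. z \<noteq> 0 \<longrightarrow> norm (f z - f 0 - D z) / norm z < 1"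
    by (simp add: eventually_at_filter)
  then have "\<forall>\<^sub>F z in nhds 0. norm (f z - f 0) \<le> (1 + onorm D) * cmod z ^ 1"
  proof eventually_elim
    case (elim z)
    show ?case
    proof (cases "z = 0")
      case False
      have "norm (f z - f 0) \<le> norm (f z - f 0 - D z) + norm (D z)"
        using norm_triangle_sub[of "f z - f 0" "D z"] by simp
      also have "norm (f z - f 0 - D z) \<le> norm z" using elim False by (simp add: field_simps)
      also have "norm (D z) \<le> onorm D * norm z" by (rule onorm[OF D.bounded_linear_axioms])
      finally show ?thesis by (simp add: algebra_simps)
    qed auto
  qed
  then show ?thesis unfolding vanishes_to_order_def by blast
qed

text \<open>The mean value inequality on the disc of radius |z| gains one factor |z| over the bound
  for the derivative.\<close>

lemma vanishes_to_order_integrate: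
  fixes r :: "complex \<Rightarrow> 'a::complex_normed_vector"
  assumes der: "\<And>z. norm z < 1 \<Longrightarrow> (r has_derivative (\<lambda>d. d *\<^sub>C r' z)) (at z)"
    and r0: "r 0 = 0" and r': "vanishes_to_order n r'"
  shows "vanishes_to_order (Suc n) r"
proof -
  from r' obtain C e where e: "e > 0" "\<And>z. dist z 0 < e \<Longrightarrow> norm (r' z) \<le> C * cmod z ^ n"
    unfolding vanishes_to_order_def eventually_nhds_metric by blast
  have "\<forall>\<^sub>F z in nhds 0. norm (r z) \<le> \<bar>C\<bar> * cmod z ^ Suc n"
    unfolding eventually_nhds_metric
  proof (intro exI[of _ "min e 1"] conjI allI impI)
    fix z :: complex assume z: "dist z 0 < min e 1"
    have "norm (r z - r 0) \<le> (\<bar>C\<bar> * cmod z ^ n) * norm (z - 0)"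
    proof (rule differentiable_bound[where S = "cball 0 (cmod z)"])
      fix w :: complex assume w: "w \<in> cball 0 (cmod z)"
      then show "(r has_derivative (\<lambda>d. d *\<^sub>C r' w)) (at w within cball 0 (cmod z))"
        using z by (intro has_derivative_at_withinI[OF der]) auto
      have "norm (r' w) \<le> C * cmod w ^ n" using w z by (intro e(2)) auto
      also have "\<dots> \<le> \<bar>C\<bar> * cmod z ^ n" using w by (intro mult_mono power_mono) auto
      finally have "norm (r' w) \<le> \<bar>C\<bar> * cmod z ^ n" .
      then have "norm (d *\<^sub>C r' w) \<le> \<bar>C\<bar> * cmod z ^ n * norm d" for d
        by (simp add: norm_scaleC mult.commute mult_left_mono)
      then show "onorm (\<lambda>d. d *\<^sub>C r' w) \<le> \<bar>C\<bar> * cmod z ^ n" by (intro onorm_bound) auto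
    qed auto
    then show "norm (r z) \<le> \<bar>C\<bar> * cmod z ^ Suc n" by (simp add: r0 mult_ac)
  qed (use e in auto)
  then show ?thesis unfolding vanishes_to_order_def by blast
qed

text \<open>Cauchy's inequality on the circle of radius r bounds the k-th derivative by a multiple
  of r^(n - k), which tends to 0 with r.\<close>

lemma vanishes_to_order_fps_nth:
  assumes hol: "h holomorphic_on ball 0 1" and ord: "vanishes_to_order n h" and k: "k < n"
  shows "fps_nth (fps_expansion h 0) k = 0"
proof -
  from ord obtain C e where e: "e > 0" "\<And>z. dist z 0 < e \<Longrightarrow> norm (h z) \<le> C * cmod z ^ n"
    unfolding vanishes_to_order_def eventually_nhds_metric by blast
  have bound: "norm ((deriv ^^ k) h 0) \<le> fact k * C * r ^ (n - k)" if r: "0 < r" "r < min e 1" for r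
  proof -
    have "norm ((deriv ^^ k) h 0) \<le> fact k * (C * r ^ n) / r ^ k"
    proof (rule Cauchy_inequality[OF _ _ r(1)])
      show "h holomorphic_on ball 0 r" using hol by (rule holomorphic_on_subset) (use r in auto)
      have "h holomorphic_on cball 0 r" using hol by (rule holomorphic_on_subset) (use r in auto)
      then show "continuous_on (cball 0 r) h" by (rule holomorphic_on_imp_continuous_on)
      show "norm (h z) \<le> C * r ^ n" if "norm (0 - z) = r" for z using e(2)[of z] that r by simp
    qed
    also have "r ^ n = r ^ (n - k) * r ^ k" using k by (simp add: power_add[symmetric])
    finally show ?thesis using r by simp
  qed
  have "((\<lambda>r. fact k * C * r ^ (n - k)) \<longlongrightarrow> fact k * C * 0 ^ (n - k)) (at_right (0::real))"
    by (intro tendsto_intros)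
  moreover have "\<forall>\<^sub>F r in at_right 0. norm ((deriv ^^ k) h 0) \<le> fact k * C * r ^ (n - k)"
    unfolding eventually_at_right_field using e(1) bound by (intro exI[of _ "min e 1"]) auto
  ultimately have "norm ((deriv ^^ k) h 0) \<le> fact k * C * 0 ^ (n - k)"
    by (intro tendsto_lowerbound) auto
  moreover have "(0::real) ^ (n - k) = 0" using k by simp
  ultimately show ?thesis using fps_nth_fps_expansion[OF has_fps_expansion_disc[OF hol], of k] by simp
qed

text \<open>A moving base point is needed for differentiation along a line. The last branch stands
  for order 5, which appears when the fourth derivative is differentiated to estimate its
  increment.\<close>

definition fderiv_pow ::
    "nat \<Rightarrow> ('a::real_normed_vector \<Rightarrow> 'b::real_normed_vector) \<Rightarrow> 'a \<Rightarrow> 'a \<Rightarrow> 'b"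
  where "fderiv_pow n F y x =
    (if n = 0 then F y
     else if n = 1 then fderiv F y x
     else if n = 2 then fderiv (fderiv F) y x x
     else if n = 3 then fderiv (fderiv (fderiv F)) y x x x
     else if n = 4 then fderiv (fderiv (fderiv (fderiv F))) y x x x x
     else fderiv (fderiv (fderiv (fderiv (fderiv F)))) y x x x x x)"

lemma fderiv_pow_at_0: "n \<le> 4 \<Longrightarrow> fderiv_pow n F 0 x = fderiv_pow0 n F x"
  by (simp add: fderiv_pow_def fderiv_pow0_def)

text \<open>Evaluation at x is bounded and linear, hence commutes with differentiation; each
  derivative along z x inserts one more argument x.\<close>

lemma has_derivative_fderiv_pow:
  fixes F :: "'a::complex_banach \<Rightarrow> 'b::complex_banach"
  assumes F: "F holomorphic_map_on U" and U: "open U" and z: "z *\<^sub>C x \<in> U" and n: "n \<le> 4"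
  shows "((\<lambda>z. fderiv_pow n F (z *\<^sub>C x) x) has_derivative
           (\<lambda>d. d *\<^sub>C fderiv_pow (Suc n) F (z *\<^sub>C x) x)) (at z)"
proof -
  note F1 = fderiv_holomorphic[OF F U]
  note F2 = fderiv_holomorphic[OF F1 U]
  note F3 = fderiv_holomorphic[OF F2 U]
  note F4 = fderiv_holomorphic[OF F3 U]
  have z0: "0 + z *\<^sub>C x \<in> U" using z by simp
  note D = has_derivative_along_line[OF _ z0, simplified add_0]
  note ap = bounded_linear.has_derivative[OF blinfun.bounded_linear_left[of x]]
  have "((\<lambda>z. F (z *\<^sub>C x)) has_derivative (\<lambda>d. d *\<^sub>C fderiv F (z *\<^sub>C x) x)) (at z)"
    by (rule D[OF F])
  moreover have "((\<lambda>z. fderiv F (z *\<^sub>C x) x) has_derivative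
      (\<lambda>d. d *\<^sub>C fderiv (fderiv F) (z *\<^sub>C x) x x)) (at z)"
    using ap[OF D[OF F1]] by (simp add: blinfun_apply_scaleC)
  moreover have "((\<lambda>z. fderiv (fderiv F) (z *\<^sub>C x) x x) has_derivative
      (\<lambda>d. d *\<^sub>C fderiv (fderiv (fderiv F)) (z *\<^sub>C x) x x x)) (at z)"
    using ap[OF ap[OF D[OF F2]]] by (simp add: blinfun_apply_scaleC)
  moreover have "((\<lambda>z. fderiv (fderiv (fderiv F)) (z *\<^sub>C x) x x x) has_derivative
      (\<lambda>d. d *\<^sub>C fderiv (fderiv (fderiv (fderiv F))) (z *\<^sub>C x) x x x x)) (at z)"
    using ap[OF ap[OF ap[OF D[OF F3]]]] by (simp add: blinfun_apply_scaleC)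
  moreover have "((\<lambda>z. fderiv (fderiv (fderiv (fderiv F))) (z *\<^sub>C x) x x x x) has_derivative
      (\<lambda>d. d *\<^sub>C fderiv (fderiv (fderiv (fderiv (fderiv F)))) (z *\<^sub>C x) x x x x x)) (at z)"
    using ap[OF ap[OF ap[OF ap[OF D[OF F4]]]]] by (simp add: blinfun_apply_scaleC)
  moreover have "n = 0 \<or> n = 1 \<or> n = 2 \<or> n = 3 \<or> n = 4" using n by auto
  ultimately show ?thesis
    unfolding fderiv_pow_def by (elim disjE) simp_all
qed

text \<open>The remainders are integrated down from the fourth derivative, whose increment is O(z),
  each integration raising the order by one. The second statement is the stage before the last, as
  DF(z x) x is the derivative of F(z x).\<close>

lemma Taylor_along_line:
  fixes F :: "'a::complex_banach \<Rightarrow> 'b::complex_banach"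
  assumes F: "F holomorphic_map_on ball 0 1" and x: "norm x = 1"
  shows "vanishes_to_order 5 (\<lambda>z. F (z *\<^sub>C x) -
      (fderiv_pow0 0 F x + z *\<^sub>C fderiv_pow0 1 F x + (z^2 / 2) *\<^sub>C fderiv_pow0 2 F x +
       (z^3 / 6) *\<^sub>C fderiv_pow0 3 F x + (z^4 / 24) *\<^sub>C fderiv_pow0 4 F x))"
    and "vanishes_to_order 4 (\<lambda>z. fderiv F (z *\<^sub>C x) x -
      (fderiv_pow0 1 F x + z *\<^sub>C fderiv_pow0 2 F x +
       (z^2 / 2) *\<^sub>C fderiv_pow0 3 F x + (z^3 / 6) *\<^sub>C fderiv_pow0 4 F x))"
proof -
  define f where "f n z = fderiv_pow n F (z *\<^sub>C x) x" for n z
  define c where "c n = fderiv_pow0 n F x" for n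
  have fc: "f n 0 = c n" if "n \<le> 4" for n using that by (simp add: f_def c_def fderiv_pow_at_0)
  have D: "(f n has_derivative (\<lambda>d. d *\<^sub>C f (Suc n) z)) (at z)" if "n \<le> 4" "cmod z < 1" for n z
    unfolding f_def using that x by (intro has_derivative_fderiv_pow[OF F]) (auto simp: norm_scaleC)
  have r4: "vanishes_to_order 1 (\<lambda>z. f 4 z - c 4)"
    using vanishes_to_order_derivative[OF D[of 4 0]] by (simp add: fc)
  have r3: "vanishes_to_order (Suc 1) (\<lambda>z. f 3 z - (c 3 + z *\<^sub>C c 4))"
  proof (rule vanishes_to_order_integrate[OF _ _ r4])
    fix z :: complex assume z: "cmod z < 1"
    show "((\<lambda>z. f 3 z - (c 3 + z *\<^sub>C c 4)) has_derivative (\<lambda>d. d *\<^sub>C (f 4 z - c 4))) (at z)"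
      by (rule derivative_eq_intros D | use z in \<open>simp add: scaleC_diff_right\<close>)+
  qed (simp add: fc)
  have r2: "vanishes_to_order (Suc (Suc 1)) (\<lambda>z. f 2 z - (c 2 + z *\<^sub>C c 3 + (z^2/2) *\<^sub>C c 4))"
  proof (rule vanishes_to_order_integrate[OF _ _ r3])
    fix z :: complex assume z: "cmod z < 1"
    show "((\<lambda>z. f 2 z - (c 2 + z *\<^sub>C c 3 + (z^2/2) *\<^sub>C c 4)) has_derivative
        (\<lambda>d. d *\<^sub>C (f 3 z - (c 3 + z *\<^sub>C c 4)))) (at z)"
      by (rule derivative_eq_intros D | use z in \<open>simp add: scaleC_diff_right scaleC_add_right scaleC_scaleC mult.commute\<close>)+
  qed (simp add: fc)
  have r1: "vanishes_to_order (Suc (Suc (Suc 1)))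
      (\<lambda>z. f 1 z - (c 1 + z *\<^sub>C c 2 + (z^2/2) *\<^sub>C c 3 + (z^3/6) *\<^sub>C c 4))"
  proof (rule vanishes_to_order_integrate[OF _ _ r2])
    fix z :: complex assume z: "cmod z < 1"
    show "((\<lambda>z. f 1 z - (c 1 + z *\<^sub>C c 2 + (z^2/2) *\<^sub>C c 3 + (z^3/6) *\<^sub>C c 4)) has_derivative
        (\<lambda>d. d *\<^sub>C (f 2 z - (c 2 + z *\<^sub>C c 3 + (z^2/2) *\<^sub>C c 4)))) (at z)"
      by (rule derivative_eq_intros D | use z in \<open>simp add: scaleC_diff_right scaleC_add_right scaleC_scaleC mult.commute numeral_2_eq_2\<close>)+
  qed (simp add: fc)
  have r0: "vanishes_to_order (Suc (Suc (Suc (Suc 1))))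
      (\<lambda>z. f 0 z - (c 0 + z *\<^sub>C c 1 + (z^2/2) *\<^sub>C c 2 + (z^3/6) *\<^sub>C c 3 + (z^4/24) *\<^sub>C c 4))"
  proof (rule vanishes_to_order_integrate[OF _ _ r1])
    fix z :: complex assume z: "cmod z < 1"
    show "((\<lambda>z. f 0 z - (c 0 + z *\<^sub>C c 1 + (z^2/2) *\<^sub>C c 2 + (z^3/6) *\<^sub>C c 3 + (z^4/24) *\<^sub>C c 4)) has_derivative
        (\<lambda>d. d *\<^sub>C (f 1 z - (c 1 + z *\<^sub>C c 2 + (z^2/2) *\<^sub>C c 3 + (z^3/6) *\<^sub>C c 4)))) (at z)"
      by (rule derivative_eq_intros D | use z in \<open>simp add: scaleC_diff_right scaleC_add_right scaleC_scaleC mult.commute numeral_2_eq_2\<close>)+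
  qed (simp add: fc)
  show "vanishes_to_order 5 (\<lambda>z. F (z *\<^sub>C x) -
      (fderiv_pow0 0 F x + z *\<^sub>C fderiv_pow0 1 F x + (z^2 / 2) *\<^sub>C fderiv_pow0 2 F x +
       (z^3 / 6) *\<^sub>C fderiv_pow0 3 F x + (z^4 / 24) *\<^sub>C fderiv_pow0 4 F x))"
    using r0 by (simp add: f_def c_def fderiv_pow_def eval_nat_numeral)
  show "vanishes_to_order 4 (\<lambda>z. fderiv F (z *\<^sub>C x) x -
      (fderiv_pow0 1 F x + z *\<^sub>C fderiv_pow0 2 F x +
       (z^2 / 2) *\<^sub>C fderiv_pow0 3 F x + (z^3 / 6) *\<^sub>C fderiv_pow0 4 F x))"
    using r1 by (simp add: f_def c_def fderiv_pow_def eval_nat_numeral)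
qed

section \<open>The curve DF(z x)^(-1) F(z x) and its generating function\<close>

text \<open>With K = norm G, norm u <= K norm (A(z) u) + K norm (A(z) - A(w)) norm u; for z near w
  the last term is at most half of norm u and is absorbed on the left, which explains the constant 2
  K.\<close>

lemma eventually_bounded_below:
  fixes A :: "complex \<Rightarrow> ('a::real_normed_vector \<Rightarrow>\<^sub>L 'a)"
  assumes cont: "isCont A w" and G: "G o\<^sub>L A w = id_blinfun"
  obtains C where "C \<ge> 0" "\<forall>\<^sub>F z in nhds w. \<forall>u. norm u \<le> C * norm (blinfun_apply (A z) u)"
proof -
  define K where "K = norm G"
  have "\<forall>\<^sub>F z in nhds w. dist (A z) (A w) < 1 / (2 * (K + 1))"
    using cont by (intro tendstoD) (auto simp: K_def isCont_def add_nonneg_pos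
        tendsto_at_iff_tendsto_nhds intro!: divide_pos_pos)
  then have "\<forall>\<^sub>F z in nhds w. \<forall>u. norm u \<le> (2 * K) * norm (blinfun_apply (A z) u)"
  proof eventually_elim
    case (elim z)
    show ?case
    proof
      fix u
      have "K * norm (A z - A w) \<le> K * (1 / (2 * (K + 1)))"
        using elim by (intro mult_left_mono) (auto simp: K_def dist_norm)
      also have "\<dots> \<le> 1 / 2" by (simp add: K_def divide_le_eq add_nonneg_pos)
      finally have half: "K * norm (A z - A w) \<le> 1 / 2" .
      have "u = blinfun_apply G (blinfun_apply (A w) u)"
        using G by (metis blinfun_apply_blinfun_compose blinfun_apply_id_blinfun id_apply)
      then have "norm u \<le> K * norm (blinfun_apply (A w) u)"
        using norm_blinfun[of G "blinfun_apply (A w) u"] by (simp add: K_def)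
      also have "norm (blinfun_apply (A w) u) \<le>
          norm (blinfun_apply (A z) u) + norm (blinfun_apply (A z - A w) u)"
        using norm_triangle_ineq4[of "blinfun_apply (A z) u" "blinfun_apply (A z - A w) u"]
        by (simp add: blinfun.diff_left)
      also have "norm (blinfun_apply (A z - A w) u) \<le> norm (A z - A w) * norm u" by (rule norm_blinfun)
      finally have "norm u \<le> K * norm (blinfun_apply (A z) u) + K * norm (A z - A w) * norm u"
        by (simp add: K_def distrib_left mult_left_mono mult.assoc)
      also have "K * norm (A z - A w) * norm u \<le> 1 / 2 * norm u"
        by (rule mult_right_mono[OF half]) simp
      finally show "norm u \<le> (2 * K) * norm (blinfun_apply (A z) u)" by simp
    qed
  qed
  then show ?thesis by (intro that[of "2 * K"]) (auto simp: K_def)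
qed

text \<open>Formal differentiation of A v = f suggests v' = G (f' - A' (v w)). That this is the
  derivative follows from the uniform lower bound for A(z) near w.\<close>

lemma solution_has_derivative:
  fixes A :: "complex \<Rightarrow> ('a::complex_normed_vector \<Rightarrow>\<^sub>L 'a)"
  assumes A: "(A has_derivative (\<lambda>d. d *\<^sub>C A')) (at w)"
    and f: "(f has_derivative (\<lambda>d. d *\<^sub>C f')) (at w)"
    and G: "G o\<^sub>L A w = id_blinfun" "A w o\<^sub>L G = id_blinfun"
    and lin: "\<forall>\<^sub>F z in nhds w. \<forall>c u. blinfun_apply (A z) (c *\<^sub>C u) = c *\<^sub>C blinfun_apply (A z) u"
    and eq: "\<forall>\<^sub>F z in nhds w. blinfun_apply (A z) (v z) = f z"
  shows "\<exists>v'. (v has_derivative (\<lambda>d. d *\<^sub>C v')) (at w)"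
proof -
  have cont: "isCont A w" using A by (rule has_derivative_continuous)
  obtain C where C: "C \<ge> 0" "\<forall>\<^sub>F z in nhds w. \<forall>u. norm u \<le> C * norm (blinfun_apply (A z) u)"
    by (rule eventually_bounded_below[OF cont G(1)])
  define v' where "v' = blinfun_apply G (f' - blinfun_apply A' (v w))"
  have Av': "blinfun_apply (A w) v' = f' - blinfun_apply A' (v w)"
    unfolding v'_def using G(2) by (metis blinfun_apply_blinfun_compose blinfun_apply_id_blinfun id_apply)
  \<comment> \<open>This is A(z) applied to v(z) - v(w) - (z - w) v', written without v(z), so that
    it can be differentiated at w; the derivative is 0 by the choice of v'.\<close>
  define h where "h z = f z - blinfun_apply (A z) (v w) - (z - w) *\<^sub>C blinfun_apply (A z) v'" for z
  note ap = bounded_linear.has_derivative[OF blinfun.bounded_linear_left A]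
  have "(h has_derivative (\<lambda>d. d *\<^sub>C f' - blinfun_apply (d *\<^sub>C A') (v w) -
      ((w - w) *\<^sub>C blinfun_apply (d *\<^sub>C A') v' + (d - 0) *\<^sub>C blinfun_apply (A w) v'))) (at w)"
    unfolding h_def by (intro derivative_intros f ap)
  then have h': "(h has_derivative (\<lambda>d. 0)) (at w)"
    by (simp add: blinfun_apply_scaleC Av' scaleC_diff_right)
  have hw: "h w = 0" using eventually_nhds_x_imp_x[OF eq] by (simp add: h_def)
  have h0: "((\<lambda>z. C * (norm (h z) / norm (z - w))) \<longlongrightarrow> C * 0) (at w)"
    using h' hw by (intro tendsto_intros) (simp add: has_derivative_iff_norm)
  have "\<forall>\<^sub>F z in nhds w. norm (v z - v w - (z - w) *\<^sub>C v') \<le> C * norm (h z)"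
    using eq lin C(2)
  proof eventually_elim
    case (elim z)
    have "blinfun_apply (A z) (v z - v w - (z - w) *\<^sub>C v') = h z"
      using elim by (simp add: h_def blinfun.diff_right)
    with elim(3) show ?case by metis
  qed
  then have le: "\<forall>\<^sub>F z in at w. norm (v z - v w - (z - w) *\<^sub>C v') \<le> C * norm (h z)"
    unfolding eventually_at_filter by (rule eventually_mono) auto
  have "((\<lambda>z. norm (v z - v w - (z - w) *\<^sub>C v') / norm (z - w)) \<longlongrightarrow> 0) (at w)"
  proof (rule tendsto_sandwich)
    show "\<forall>\<^sub>F z in at w. 0 \<le> norm (v z - v w - (z - w) *\<^sub>C v') / norm (z - w)" by simp
    show "\<forall>\<^sub>F z in at w. norm (v z - v w - (z - w) *\<^sub>C v') / norm (z - w) \<le> C * (norm (h z) / norm (z - w))"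
      using le by eventually_elim (simp add: divide_right_mono)
    show "((\<lambda>z. C * (norm (h z) / norm (z - w))) \<longlongrightarrow> 0) (at w)" using h0 by simp
  qed simp
  then have "(v has_derivative (\<lambda>d. d *\<^sub>C v')) (at w)"
    unfolding has_derivative_iff_norm using bounded_linear_scaleC_left by blast
  then show ?thesis ..
qed

lemma spirallikeD:
  assumes "F \<in> spirallike \<beta>"
  shows "F holomorphic_map_on ball 0 1" "F 0 = 0" "fderiv F 0 = id_blinfun"
    and "x \<in> ball 0 1 \<Longrightarrow> \<exists>G. G o\<^sub>L fderiv F x = id_blinfun \<and> fderiv F x o\<^sub>L G = id_blinfun"
    and "x \<in> ball 0 1 \<Longrightarrow> x \<noteq> 0 \<Longrightarrow> T \<in> support_functionals x \<Longrightarrow>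
      Re (exp (- (\<i> * complex_of_real \<beta>)) * T (inv (blinfun_apply (fderiv F x)) (F x))) > 0"
  using assms
  by (auto simp: spirallike_def normalized_def locally_biholomorphic_def holomorphic_on_ball_def
      holomorphic_map_on_def)

lemma inv_blinfun_apply:
  assumes "A o\<^sub>L G = id_blinfun"
  shows "blinfun_apply A (inv (blinfun_apply A) y) = y"
proof (rule surj_f_inv_f, rule surjI)
  show "blinfun_apply A (blinfun_apply G y) = y" for y
    using assms by (metis blinfun_apply_blinfun_compose blinfun_apply_id_blinfun id_apply)
qed

text \<open>The unimodular factor \<open>cnj (sgn z)\<close> makes the value at the rotated vector
  positive, so one T serves the whole complex line through x.\<close>

lemma support_functional_rotate:
  assumes T: "T \<in> support_functionals x" and z: "z \<noteq> 0" and x: "x \<noteq> 0"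
  shows "(\<lambda>y. cnj (sgn z) * T y) \<in> support_functionals (z *\<^sub>C x)"
proof (rule support_functionalI)
  have bT: "bounded_clinear T" and Tx: "T x = of_real (norm x)"
    using T by (auto simp: support_functionals_def)
  show "bounded_clinear (\<lambda>y. cnj (sgn z) * T y)"
    using bT bounded_linear_const_mult[of T "cnj (sgn z)"]
    by (auto simp: bounded_clinear_def scaleC_complex_def)
  have "cnj (sgn z) * z = of_real (cmod z)"
    using z complex_norm_square[of z]
    by (simp add: sgn_eq power2_eq_square mult.commute divide_eq_eq)
  then show "cnj (sgn z) * T (z *\<^sub>C x) = of_real (norm (z *\<^sub>C x))"
    by (simp add: bounded_clinear_scaleC[OF bT] scaleC_complex_def Tx norm_scaleC mult.assoc[symmetric])
  show "z *\<^sub>C x \<noteq> 0" using z x norm_scaleC[of z x] by auto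
  show "cmod (cnj (sgn z) * T y) \<le> norm y" for y
    using support_functional_norm_le[OF T, of y] z by (simp add: norm_mult norm_sgn)
qed

text \<open>\<open>v z\<close> is the curve \<open>DF(z x)\<inverse> F(z x)\<close>. As the low-order terms of \<open>F\<close> point in the direction of
  \<open>x\<close>, so do those of \<open>v\<close>; their coefficients come from comparing \<open>DF(z x) x\<close>, the velocity of the
  curve \<open>F(z x)\<close>, with that curve.\<close>

lemma spirallike_generating_function:
  fixes F :: "'a::complex_banach \<Rightarrow> 'a"
  assumes F: "F \<in> spirallike \<beta>" and x: "norm x = 1" and T: "T \<in> support_functionals x"
    and a: "fderiv_pow0 2 F x = (2 * a2) *\<^sub>C x" "fderiv_pow0 3 F x = (6 * a3) *\<^sub>C x"
      "fderiv_pow0 4 F x = (24 * a4) *\<^sub>C x"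
  obtains g where "g holomorphic_on ball 0 1"
    "\<And>z. norm z < 1 \<Longrightarrow> z \<noteq> 0 \<Longrightarrow> Re (exp (- (\<i> * of_real \<beta>)) * g z) > 0"
    "g 0 = 1" "fps_nth (fps_expansion g 0) 1 = - a2"
    "fps_nth (fps_expansion g 0) 2 = 2 * (a2\<^sup>2 - a3)"
    "fps_nth (fps_expansion g 0) 3 = - 3 * a4 + 7 * a2 * a3 - 4 * a2 ^ 3"
proof -
  note FD = spirallikeD[OF F]
  note DF = fderiv_holomorphic[OF FD(1) open_ball]
  have bT: "bounded_clinear T" and Tx: "T x = 1" using T x by (auto simp: support_functionals_def)
  interpret T: bounded_linear T using bT by (rule bounded_clinear_bounded_linear)
  have in_ball: "z *\<^sub>C x \<in> ball 0 1" if "cmod z < 1" for z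
    using that x by (simp add: norm_scaleC)
  have near: "\<forall>\<^sub>F z in nhds w. cmod z < 1" if "cmod w < 1" for w :: complex
  proof -
    have "\<forall>\<^sub>F z in nhds w. z \<in> ball 0 1" using that by (intro eventually_nhds_in_open) auto
    then show ?thesis by (rule eventually_mono) auto
  qed
  define A where "A z = fderiv F (z *\<^sub>C x)" for z
  define v where "v z = inv (blinfun_apply (A z)) (F (z *\<^sub>C x))" for z
  have inv: "\<exists>G. G o\<^sub>L A z = id_blinfun \<and> A z o\<^sub>L G = id_blinfun" if "cmod z < 1" for z
    unfolding A_def by (rule FD(4)[OF in_ball[OF that]])
  have Av: "blinfun_apply (A z) (v z) = F (z *\<^sub>C x)" if "cmod z < 1" for z
    using inv[OF that] unfolding v_def by (metis inv_blinfun_apply)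
  have lin: "blinfun_apply (A z) (c *\<^sub>C u) = c *\<^sub>C blinfun_apply (A z) u" if "cmod z < 1" for z c u
    unfolding A_def by (rule fderiv_scaleC[OF FD(1) in_ball[OF that]])
  have A': "(A has_derivative (\<lambda>d. d *\<^sub>C blinfun_apply (fderiv (fderiv F) (z *\<^sub>C x)) x)) (at z)"
    if "cmod z < 1" for z
    using has_derivative_along_line[OF DF, of 0 z x] in_ball[OF that] by (simp add: A_def[abs_def])
  have F': "((\<lambda>z. F (z *\<^sub>C x)) has_derivative (\<lambda>d. d *\<^sub>C blinfun_apply (fderiv F (z *\<^sub>C x)) x)) (at z)"
    if "cmod z < 1" for z
    using has_derivative_along_line[OF FD(1), of 0 z x] in_ball[OF that] by simp
  define \<psi> where "\<psi> z = T (v z)" for z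
  have \<psi>: "\<psi> holomorphic_on ball 0 1"
    unfolding holomorphic_on_open[OF open_ball]
  proof
    fix z :: complex assume "z \<in> ball 0 1"
    then have z: "cmod z < 1" by simp
    obtain G where G: "G o\<^sub>L A z = id_blinfun" "A z o\<^sub>L G = id_blinfun" using inv[OF z] by blast
    obtain v' where "(v has_derivative (\<lambda>d. d *\<^sub>C v')) (at z)"
    proof (rule exE[OF solution_has_derivative[OF A'[OF z] F'[OF z] G]])
      show "\<forall>\<^sub>F z in nhds z. \<forall>c u. blinfun_apply (A z) (c *\<^sub>C u) = c *\<^sub>C blinfun_apply (A z) u"
        by (rule eventually_mono[OF near[OF z]]) (simp add: lin)
      show "\<forall>\<^sub>F z in nhds z. blinfun_apply (A z) (v z) = F (z *\<^sub>C x)"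
        by (rule eventually_mono[OF near[OF z]]) (simp add: Av)
    qed
    from T.has_derivative[OF this] show "\<exists>D. (\<psi> has_field_derivative D) (at z)"
      unfolding \<psi>_def
      by (intro exI[of _ "T v'"] has_derivative_imp_has_field_derivative)
         (auto simp: bounded_clinear_scaleC[OF bT] scaleC_complex_def)
  qed
  have A0: "A 0 = id_blinfun" using FD(3) by (simp add: A_def)
  have \<psi>0: "\<psi> 0 = 0" using Av[of 0] FD(2) by (simp add: A0 \<psi>_def T.zero)
  obtain g where g: "g holomorphic_on ball 0 1" "\<And>z. norm z < 1 \<Longrightarrow> \<psi> z = z * g z" "deriv \<psi> 0 = g 0"
    using Schwarz3[OF \<psi> \<psi>0] by blast
  \<comment> \<open>The coefficients up to z^3 of q / (z q'), where q' is the derivative of the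
    scalar polynomial q; accordingly p is q / q' truncated after z^4.\<close>
  define c1 c2 c3 where "c1 = - a2" and "c2 = 2 * (a2\<^sup>2 - a3)"
    and "c3 = - 3 * a4 + 7 * a2 * a3 - 4 * a2 ^ 3"
  define p where "p z = z * (1 + z * (c1 + z * (c2 + z * c3)))" for z
  define q where "q z = z + a2 * z ^ 2 + a3 * z ^ 3 + a4 * z ^ 4" for z
  define q' where "q' z = 1 + 2 * a2 * z + 3 * a3 * z ^ 2 + 4 * a4 * z ^ 3" for z
  have c01: "fderiv_pow0 0 F x = 0" "fderiv_pow0 1 F x = x"
    using FD(2,3) by (simp_all add: fderiv_pow0_def)
  have f0: "vanishes_to_order 5 (\<lambda>z. F (z *\<^sub>C x) - q z *\<^sub>C x)"
    using Taylor_along_line(1)[OF FD(1) x] unfolding a c01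
    by (simp add: q_def scaleC_scaleC scaleC_add_left[symmetric] mult_ac)
  have f1: "vanishes_to_order 4 (\<lambda>z. fderiv F (z *\<^sub>C x) x - q' z *\<^sub>C x)"
    using Taylor_along_line(2)[OF FD(1) x] unfolding a c01
    by (simp add: q'_def scaleC_scaleC scaleC_add_left mult_ac)
  have id1: "vanishes_to_order n (\<lambda>z::complex. z ^ n)" for n
    by (rule vanishes_to_orderI[of _ 1]) (simp add: norm_power)
  have "vanishes_to_order (1 + 0) (\<lambda>z. z ^ 1 *\<^sub>C (1 + z * (c1 + z * (c2 + z * c3))))"
    by (intro vanishes_to_order_scaleC id1 vanishes_to_order_isCont continuous_intros)
  then have ord1: "vanishes_to_order 1 p" by (simp add: p_def[abs_def] scaleC_complex_def)
  \<comment> \<open>The cofactor of z^5 left over by the truncation, from multiplying out p q'; what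
    counts is its continuity at 0.\<close>
  define r where "r z = - (4 * a4 * c1 + 3 * a3 * c2 + 2 * a2 * c3)
      - z * (4 * a4 * c2 + 3 * a3 * c3) - z\<^sup>2 * (4 * a4 * c3)" for z
  have qpr: "q z - p z * q' z = z ^ 5 * r z" for z
    unfolding p_def q_def q'_def c1_def c2_def c3_def r_def
    by (simp add: algebra_simps eval_nat_numeral)
  have "vanishes_to_order (5 + 0) (\<lambda>z. z ^ 5 *\<^sub>C (r z *\<^sub>C x))"
    unfolding r_def
    by (intro vanishes_to_order_scaleC id1 vanishes_to_order_isCont continuous_intros
        bounded_bilinear.isCont[OF bounded_bilinear_scaleC])
  then have e1: "vanishes_to_order 5 (\<lambda>z. (q z - p z * q' z) *\<^sub>C x)"
    by (simp add: qpr scaleC_scaleC)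
  \<comment> \<open>The velocity DF(z x) x is known only up to O(z^4); the missing order is supplied
    by p = O(z).\<close>
  have e2: "vanishes_to_order 5 (\<lambda>z. p z *\<^sub>C (fderiv F (z *\<^sub>C x) x - q' z *\<^sub>C x))"
    using vanishes_to_order_scaleC[OF ord1 f1] by simp
  have h: "vanishes_to_order 5 (\<lambda>z. F (z *\<^sub>C x) - p z *\<^sub>C fderiv F (z *\<^sub>C x) x)"
    using vanishes_to_order_add[OF vanishes_to_order_diff[OF f0 e2] e1]
    by (simp add: scaleC_diff_right scaleC_diff_left scaleC_scaleC)
  obtain G where G: "G o\<^sub>L A 0 = id_blinfun" using inv[of 0] by auto
  have A_cont: "isCont A 0" using A'[of 0] by (intro has_derivative_continuous) auto
  obtain C where C: "C \<ge> 0" "\<forall>\<^sub>F z in nhds 0. \<forall>u. norm u \<le> C * norm (blinfun_apply (A z) u)"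
    by (rule eventually_bounded_below[OF A_cont G])
  have "\<forall>\<^sub>F z in nhds 0. norm (v z - p z *\<^sub>C x) \<le> C * norm (F (z *\<^sub>C x) - p z *\<^sub>C fderiv F (z *\<^sub>C x) x)"
    using C(2) near[of 0, simplified]
  proof eventually_elim
    case (elim z)
    \<comment> \<open>The operator DF(z x) maps the error v - p x to the remainder estimated in
      \<open>h\<close>, so its lower bound gives the same order for v - p x.\<close>
    have "blinfun_apply (A z) (v z - p z *\<^sub>C x) = F (z *\<^sub>C x) - p z *\<^sub>C fderiv F (z *\<^sub>C x) x"
      using Av[OF elim(2)] lin[OF elim(2)] by (simp add: blinfun.diff_right A_def)
    with elim(1) show ?case by metis
  qed
  from vanishes_to_order_dominated[OF h this C(1)]
  have vp: "vanishes_to_order 5 (\<lambda>z. v z - p z *\<^sub>C x)" .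
  have Tvp: "norm (\<psi> z - p z) \<le> 1 * norm (v z - p z *\<^sub>C x)" for z
    using support_functional_norm_le[OF T, of "v z - p z *\<^sub>C x"]
    by (simp add: \<psi>_def T.diff bounded_clinear_scaleC[OF bT] scaleC_complex_def Tx)
  have ord: "vanishes_to_order 5 (\<lambda>z. \<psi> z - p z)"
    by (rule vanishes_to_order_dominated[OF vp always_eventually[OF allI[OF Tvp]]]) simp
  have hol: "(\<lambda>z. \<psi> z - p z) holomorphic_on ball 0 1"
    unfolding p_def by (intro holomorphic_intros \<psi>)
  define H where "H = fps_expansion g 0"
  define P where "P = fps_X * (1 + fps_X * (fps_const c1 + fps_X * (fps_const c2 + fps_X * fps_const c3)))"
  have gH: "g has_fps_expansion H" unfolding H_def by (rule has_fps_expansion_disc[OF g(1)])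
  have "fps_expansion (\<lambda>z. \<psi> z - p z) 0 = fps_X * H - P"
  proof (rule fps_eq_on_disc[OF has_fps_expansion_disc[OF hol]])
    show "(\<lambda>z. z * g z - p z) has_fps_expansion fps_X * H - P"
      unfolding p_def P_def by (intro fps_expansion_intros gH)
  qed (simp add: g(2))
  \<comment> \<open>Since \<psi> = z g, the coefficients of \<psi> up to z^4 yield those of g up to
    z^3; hence the need for order 5.\<close>
  then have coef: "fps_nth (fps_X * H) k = fps_nth P k" if "k < 5" for k
    using vanishes_to_order_fps_nth[OF hol ord that] by simp
  show ?thesis
  proof (rule that[OF g(1)])
    fix z :: complex assume z: "norm z < 1" "z \<noteq> 0"
    have "x \<noteq> 0" using x by auto
    \<comment> \<open>The rotated functional turns z g into |z| g, and the positive factor |z| drops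
      out of the sign condition.\<close>
    have "cnj (sgn z) * z = of_real (cmod z)"
      using z complex_norm_square[of z]
      by (simp add: sgn_eq power2_eq_square mult.commute divide_eq_eq)
    then have "cnj (sgn z) * \<psi> z = of_real (cmod z) * g z"
      by (simp add: g(2)[OF z(1)] mult.assoc[symmetric])
    moreover have "z *\<^sub>C x \<noteq> 0" using z \<open>x \<noteq> 0\<close> norm_scaleC[of z x] by auto
    then have "Re (exp (- (\<i> * of_real \<beta>)) * (cnj (sgn z) * \<psi> z)) > 0"
      using FD(5)[OF in_ball[OF z(1)] _ support_functional_rotate[OF T z(2) \<open>x \<noteq> 0\<close>]]
      by (simp add: \<psi>_def v_def A_def)
    moreover have Re_of_real_mult: "Re (of_real a * w) = a * Re w" for a w by simp
    ultimately have "Re (of_real (cmod z) * (exp (- (\<i> * of_real \<beta>)) * g z)) > 0"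
      by (simp only: mult_ac)
    then show "Re (exp (- (\<i> * of_real \<beta>)) * g z) > 0"
      unfolding Re_of_real_mult using z(2) by (simp only: zero_less_mult_iff zero_less_norm_iff) auto
  next
    show "g 0 = 1" using coef[of 1] fps_expansion_0[OF g(1)] by (simp add: P_def H_def)
    show "fps_nth (fps_expansion g 0) 1 = - a2"
      using coef[of 2] by (simp add: P_def H_def c1_def)
    show "fps_nth (fps_expansion g 0) 2 = 2 * (a2\<^sup>2 - a3)"
      using coef[of 3] by (simp add: P_def H_def c2_def)
    show "fps_nth (fps_expansion g 0) 3 = - 3 * a4 + 7 * a2 * a3 - 4 * a2 ^ 3"
      using coef[of 4] by (simp add: P_def H_def c3_def)
  qed
qed

text \<open>As D^n F(0)(x^n) is a multiple of x and T x = 1, the A_n are the scalars a2, a3, a4. In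
  the expression in the coefficients of g the terms with a2^4 cancel, and a2 a4 - a3^2
  remains.\<close>

lemma spirallike_hankel_bound:
  fixes F :: "'a::complex_banach \<Rightarrow> 'a"
  assumes F: "F \<in> spirallike \<beta>" and rad: "radial_terms F" and \<beta>: "cos \<beta> > 0"
    and x: "norm x = 1" and T: "T \<in> support_functionals x"
  shows "cmod (hankel22 F x T) \<le> (cos \<beta>)\<^sup>2"
proof -
  have bT: "bounded_clinear T" and Tx: "T x = 1" using T x by (auto simp: support_functionals_def)
  have "\<exists>a. fderiv_pow0 (k + 1) F x = (fact (k + 1) * a) *\<^sub>C x" if k: "k \<in> {1,2,3}" for k
  proof -
    obtain a where "fderiv_pow0 (k + 1) F x /\<^sub>R fact (k + 1) = a *\<^sub>C x"
      using rad k unfolding radial_terms_def by blast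
    then have "fact (k + 1) *\<^sub>R (fderiv_pow0 (k + 1) F x /\<^sub>R fact (k + 1)) = fact (k + 1) *\<^sub>R (a *\<^sub>C x)"
      by simp
    then have "fderiv_pow0 (k + 1) F x = fact (k + 1) *\<^sub>R (a *\<^sub>C x)"
      by (simp del: fact_Suc)
    also have "\<dots> = (fact (k + 1) * a) *\<^sub>C x"
      unfolding scaleC_of_real[symmetric] scaleC_scaleC by (simp del: fact_Suc)
    finally show ?thesis ..
  qed
  from this[of 1] this[of 2] this[of 3] obtain a2 a3 a4
    where a: "fderiv_pow0 2 F x = (2 * a2) *\<^sub>C x" "fderiv_pow0 3 F x = (6 * a3) *\<^sub>C x"
      "fderiv_pow0 4 F x = (24 * a4) *\<^sub>C x"
    by (auto simp: fact_numeral eval_nat_numeral)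
  obtain g where g: "g holomorphic_on ball 0 1"
    "\<And>z. norm z < 1 \<Longrightarrow> z \<noteq> 0 \<Longrightarrow> Re (exp (- (\<i> * of_real \<beta>)) * g z) > 0"
    "g 0 = 1" "fps_nth (fps_expansion g 0) 1 = - a2"
    "fps_nth (fps_expansion g 0) 2 = 2 * (a2\<^sup>2 - a3)"
    "fps_nth (fps_expansion g 0) 3 = - 3 * a4 + 7 * a2 * a3 - 4 * a2 ^ 3"
    using spirallike_generating_function[OF F x T a] by blast
  \<comment> \<open>At z = 0 the spirallike condition gives nothing; there g = 1 and the value is
    cos \<beta>.\<close>
  have "Re (exp (- (\<i> * of_real \<beta>)) * g z) > 0" if "norm z < 1" for z
    using g(2,3) that \<beta> by (cases "z = 0") (auto simp: Re_exp)
  from spirallike_coefficient_bound[OF g(1,3) this]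
  have "cmod (- a2 * (- 3 * a4 + 7 * a2 * a3 - 4 * a2 ^ 3) / 3 - (2 * (a2\<^sup>2 - a3))\<^sup>2 / 4
      - (- a2)\<^sup>2 * (2 * (a2\<^sup>2 - a3)) / 6) \<le> (cos \<beta>)\<^sup>2"
    unfolding g(4-6) .
  also have "- a2 * (- 3 * a4 + 7 * a2 * a3 - 4 * a2 ^ 3) / 3 - (2 * (a2\<^sup>2 - a3))\<^sup>2 / 4
      - (- a2)\<^sup>2 * (2 * (a2\<^sup>2 - a3)) / 6 = a2 * a4 - a3\<^sup>2"
    by (simp add: field_simps eval_nat_numeral)
  finally show ?thesis
    by (simp add: hankel22_def coeff_A_def a bounded_clinear_scaleC[OF bT] scaleC_complex_def Tx fact_numeral)
qed

subsection \<open>Sharpness\<close>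

lemma homogeneous_polynomial_power:
  fixes u :: "'a::complex_normed_vector \<Rightarrow> complex"
  assumes u: "bounded_clinear u" and le: "\<And>y. cmod (u y) \<le> norm y"
  shows "homogeneous_polynomial k (\<lambda>x. a * u x ^ k)"
proof -
  interpret u: bounded_linear u using u by (rule bounded_clinear_bounded_linear)
  define L where "L v = a * (\<Prod>i<k. u (v i))" for v :: "nat \<Rightarrow> 'a"
  have upd: "L (v(i := w)) = a * (u w * (\<Prod>j\<in>{..<k} - {i}. u (v j)))" if "i < k" for v i w
  proof -
    have "(\<Prod>j<k. u ((v(i := w)) j)) = u w * (\<Prod>j\<in>{..<k} - {i}. u ((v(i := w)) j))"
      using that by (subst prod.remove[of _ i]) auto
    also have "(\<Prod>j\<in>{..<k} - {i}. u ((v(i := w)) j)) = (\<Prod>j\<in>{..<k} - {i}. u (v j))"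
      by (rule prod.cong) auto
    finally show ?thesis by (simp add: L_def)
  qed
  have "cmod (L v) \<le> cmod a * (\<Prod>i<k. norm (v i))" for v
    unfolding L_def norm_mult prod_norm[symmetric] by (intro mult_left_mono prod_mono) (auto simp: le)
  then have "bounded_multilinear_form k L"
    unfolding bounded_multilinear_form_def
    by (intro conjI allI impI exI[of _ "cmod a"])
       (auto simp: upd u.add bounded_clinear_scaleC[OF u] scaleC_complex_def algebra_simps,
        simp add: L_def)
  moreover have "a * u x ^ k = L (\<lambda>_. x)" for x by (simp add: L_def)
  ultimately show ?thesis unfolding homogeneous_polynomial_def by blast
qed

section \<open>Mappings of the form h(u(x)) x\<close>

text \<open>Each homogeneous term of h(u(x)) x is a power of u times x, so all terms are radial, and
  the derivative is a multiple of the identity plus an operator of rank at most one, which can be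
  inverted explicitly.\<close>

locale radial_map =
  fixes u :: "'a::complex_banach \<Rightarrow> complex" and h :: "complex \<Rightarrow> complex"
  assumes u: "bounded_clinear u" and u_le: "\<And>y. cmod (u y) \<le> norm y"
    and h: "h holomorphic_on ball 0 1"
begin

definition F :: "'a \<Rightarrow> 'a" where "F x = h (u x) *\<^sub>C x"

lemma u_scaleC: "u (c *\<^sub>C x) = c * u x"
  using bounded_clinear_scaleC[OF u] by (simp add: scaleC_complex_def)

lemma u_add: "u (x + y) = u x + u y" and u_diff: "u (x - y) = u x - u y"
  using bounded_linear.linear[OF bounded_clinear_bounded_linear[OF u]]
  by (simp_all add: linear_add linear_diff)

lemma u_less_1: "x \<in> ball 0 1 \<Longrightarrow> cmod (u x) < 1"
  using u_le[of x] by simp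

lemma has_derivative_F:
  assumes "x \<in> ball 0 1"
  shows "(F has_derivative (\<lambda>y. h (u x) *\<^sub>C y + (deriv h (u x) * u y) *\<^sub>C x)) (at x)"
proof -
  have "(h has_field_derivative deriv h (u x)) (at (u x))"
    using h u_less_1[OF assms] by (intro holomorphic_derivI[of h "ball 0 1"]) auto
  then have "(h has_derivative (*) (deriv h (u x))) (at (u x))"
    by (simp add: has_field_derivative_def)
  from has_derivative_compose[OF bounded_linear_imp_has_derivative[OF bounded_clinear_bounded_linear[OF u]] this]
  have "((\<lambda>x. h (u x)) has_derivative (\<lambda>y. deriv h (u x) * u y)) (at x)" .
  from has_derivative_scaleC[OF this has_derivative_ident] show ?thesis
    unfolding F_def .
qed

lemma F_holomorphic: "F holomorphic_map_on ball 0 1"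
  by (rule holomorphic_map_onI[OF has_derivative_F])
     (simp_all add: scaleC_add_right scaleC_scaleC u_scaleC mult_ac)

lemma fderiv_F:
  "x \<in> ball 0 1 \<Longrightarrow> blinfun_apply (fderiv F x) y = h (u x) *\<^sub>C y + (deriv h (u x) * u y) *\<^sub>C x"
  using fderiv_eqI[OF has_derivative_F] by simp

text \<open>With a = h(u(x)) and b = h'(u(x)), the operator y |-> a y + b u(y) x is inverted by the
  Sherman-Morrison formula, the origin of the constant \<open>c\<close>. Moreover x is an
  eigenvector with eigenvalue a + b u(x), which gives the preimage of F(x) = a x.\<close>

lemma fderiv_F_inverse:
  assumes x: "x \<in> ball 0 1" and nz: "h (u x) \<noteq> 0" "h (u x) + u x * deriv h (u x) \<noteq> 0"
  shows "\<exists>G. G o\<^sub>L fderiv F x = id_blinfun \<and> fderiv F x o\<^sub>L G = id_blinfun"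
    and "inv (blinfun_apply (fderiv F x)) (F x) = (h (u x) / (h (u x) + u x * deriv h (u x))) *\<^sub>C x"
proof -
  define a b where "a = h (u x)" and "b = deriv h (u x)"
  note ab = a_def[symmetric] b_def[symmetric]
  have nz': "a \<noteq> 0" "a + u x * b \<noteq> 0" using nz by (simp_all add: ab)
  define c where "c = b / (a * (a + u x * b))"
  define G where "G = Blinfun (\<lambda>y. inverse a *\<^sub>C y - (c * u y) *\<^sub>C x)"
  have "bounded_linear (\<lambda>y. inverse a *\<^sub>C y - (c * u y) *\<^sub>C x)"
    by (intro bounded_linear_sub bounded_linear_scaleC_right
        bounded_linear_compose[OF bounded_linear_scaleC_left]
        bounded_linear_compose[OF bounded_linear_mult_right] bounded_clinear_bounded_linear[OF u])
  then have G: "blinfun_apply G y = inverse a *\<^sub>C y - (c * u y) *\<^sub>C x" for y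
    by (simp add: G_def bounded_linear_Blinfun_apply)
  have D: "blinfun_apply (fderiv F x) y = a *\<^sub>C y + (b * u y) *\<^sub>C x" for y
    using fderiv_F[OF x] by (simp add: ab)
  have id: "inverse a * b = c * (a + b * u x)" "b * (inverse a - c * u x) = a * c"
  proof -
    show 1: "inverse a * b = c * (a + b * u x)"
      using nz' unfolding c_def by (simp only: mult.commute[of b]) (simp add: divide_inverse)
    have "b * (inverse a - c * u x) = inverse a * b - c * (b * u x)" by (simp add: algebra_simps)
    then show "b * (inverse a - c * u x) = a * c" unfolding 1 by (simp add: algebra_simps)
  qed
  have GD: "blinfun_apply G (blinfun_apply (fderiv F x) y) = y" for y
  proof -
    have "blinfun_apply G (blinfun_apply (fderiv F x) y) =
        y + (inverse a * b * u y - c * (a + b * u x) * u y) *\<^sub>C x"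
      unfolding G D using nz'
      by (simp add: u_add u_scaleC scaleC_add_right scaleC_scaleC scaleC_diff_left algebra_simps
          scaleC_add_left)
    then show ?thesis by (simp add: id(1))
  qed
  have DG: "blinfun_apply (fderiv F x) (blinfun_apply G y) = y" for y
  proof -
    have "blinfun_apply (fderiv F x) (blinfun_apply G y) =
        y + (b * (inverse a - c * u x) * u y - a * c * u y) *\<^sub>C x"
      unfolding G D using nz'
      by (simp add: u_diff u_scaleC scaleC_diff_right scaleC_scaleC scaleC_diff_left algebra_simps
          scaleC_add_left)
    then show ?thesis by (simp add: id(2))
  qed
  show "\<exists>G. G o\<^sub>L fderiv F x = id_blinfun \<and> fderiv F x o\<^sub>L G = id_blinfun"
    using GD DG by (intro exI[of _ G] conjI blinfun_eqI) auto
  have "inj (blinfun_apply (fderiv F x))" using GD by (metis injI)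
  moreover have "blinfun_apply (fderiv F x) ((a / (a + u x * b)) *\<^sub>C x) = F x"
  proof -
    have factor: "a * r + b * (r * u x) = r * (a + u x * b)" for r by (simp add: algebra_simps)
    have "a * (a / (a + u x * b)) + b * (a / (a + u x * b) * u x) = a"
      unfolding factor using nz'(2) by simp
    then show ?thesis
      by (simp add: D u_scaleC scaleC_scaleC scaleC_add_left[symmetric] F_def ab)
  qed
  ultimately show "inv (blinfun_apply (fderiv F x)) (F x) = (h (u x) / (h (u x) + u x * deriv h (u x))) *\<^sub>C x"
    unfolding ab by (metis inv_f_f)
qed

text \<open>On the line through x, F(z x) = z h(z u(x)) x is a scalar function times a fixed vector.
  Both sides are differentiated on the open set \<open>S\<close> of all z with z x in the ball, and
  uniqueness of derivatives carries the induction.\<close>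

lemma fderiv_pow0_F:
  assumes n: "n \<le> 4"
  shows "fderiv_pow0 n F x = (deriv ^^ n) (\<lambda>z. z * h (z * u x)) 0 *\<^sub>C x"
proof -
  define S where "S = (\<lambda>z. z *\<^sub>C x) -` ball 0 1"
  have "open S" unfolding S_def
    by (intro open_vimage open_ball continuous_intros)
  let ?Q = "\<lambda>z. z * h (z * u x)"
  have Q: "?Q holomorphic_on S"
  proof (intro holomorphic_intros holomorphic_on_compose_gen[OF _ h, unfolded o_def])
    show "(\<lambda>z. z * u x) ` S \<subseteq> ball 0 1"
      using u_less_1 unfolding S_def by (auto simp: u_scaleC[symmetric])
  qed
  have "fderiv_pow n F (z *\<^sub>C x) x = (deriv ^^ n) ?Q z *\<^sub>C x" if "z \<in> S" for z
    using n that
  proof (induction n arbitrary: z)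
    case 0
    then show ?case by (simp add: fderiv_pow_def F_def u_scaleC scaleC_scaleC mult.commute)
  next
    case (Suc n)
    have zb: "z *\<^sub>C x \<in> ball 0 1" using Suc.prems by (simp add: S_def)
    have 1: "((\<lambda>z. fderiv_pow n F (z *\<^sub>C x) x) has_derivative
        (\<lambda>d. d *\<^sub>C fderiv_pow (Suc n) F (z *\<^sub>C x) x)) (at z)"
      by (rule has_derivative_fderiv_pow[OF F_holomorphic open_ball zb]) (use Suc.prems in simp)
    have "((deriv ^^ n) ?Q has_field_derivative (deriv ^^ Suc n) ?Q z) (at z)"
      by (rule has_field_derivative_higher_deriv[OF Q \<open>open S\<close> Suc.prems(2)])
    then have "((deriv ^^ n) ?Q has_derivative (\<lambda>d. d * (deriv ^^ Suc n) ?Q z)) (at z)"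
      by (simp add: has_field_derivative_def mult_commute_abs)
    from bounded_linear.has_derivative[OF bounded_linear_scaleC_left this]
    have "((\<lambda>z. (deriv ^^ n) ?Q z *\<^sub>C x) has_derivative (\<lambda>d. (d * (deriv ^^ Suc n) ?Q z) *\<^sub>C x)) (at z)" .
    then have 2: "((\<lambda>z. fderiv_pow n F (z *\<^sub>C x) x) has_derivative
        (\<lambda>d. (d * (deriv ^^ Suc n) ?Q z) *\<^sub>C x)) (at z)"
      by (rule has_derivative_transform_within_open[OF _ \<open>open S\<close> Suc.prems(2)])
         (use Suc in simp)
    from fun_cong[OF has_derivative_unique[OF 1 2], of 1] show ?case by simp
  qed
  from this[of 0] show ?thesis using n by (simp add: S_def fderiv_pow_at_0)
qed

text \<open>The factor z in z h(z u(x)) shifts the index: order k + 1 of F belongs to coefficient k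
  of h.\<close>

lemma fderiv_pow0_F_Suc:
  assumes k: "k \<le> 3"
  shows "fderiv_pow0 (Suc k) F x =
    (fact (Suc k) * (fps_nth (fps_expansion h 0) k * u x ^ k)) *\<^sub>C x"
proof -
  have "(\<lambda>z. z * (h \<circ> (\<lambda>z. u x * z)) z) has_fps_expansion
      fps_X * (fps_expansion h 0 oo (fps_const (u x) * fps_X))"
    by (intro fps_expansion_intros has_fps_expansion_compose has_fps_expansion_disc[OF h]) auto
  from fps_nth_fps_expansion[OF this, of "Suc k"]
  have "u x ^ k * fps_nth (fps_expansion h 0) k =
      (deriv ^^ Suc k) (\<lambda>z. z * h (z * u x)) 0 / fact (Suc k)"
    by (simp add: fps_compose_linear o_def mult.commute[of "u x"] del: fact_Suc funpow.simps)
  then have "(deriv ^^ Suc k) (\<lambda>z. z * h (z * u x)) 0 =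
      fact (Suc k) * (fps_nth (fps_expansion h 0) k * u x ^ k)"
    by (simp add: field_simps del: fact_Suc funpow.simps)
  then show ?thesis using fderiv_pow0_F[of "Suc k" x] k by (simp only:)
qed

lemma radial_terms_F: "radial_terms F"
  unfolding radial_terms_def
proof
  fix k :: nat assume k: "k \<in> {1, 2, 3}"
  define a where "a = fps_nth (fps_expansion h 0) k"
  have "fderiv_pow0 (k + 1) F x /\<^sub>R fact (k + 1) = (a * u x ^ k) *\<^sub>C x" for x
  proof -
    have "fderiv_pow0 (k + 1) F x = (fact (k + 1) * (a * u x ^ k)) *\<^sub>C x"
      using fderiv_pow0_F_Suc[of k x] k by (auto simp: a_def)
    also have "\<dots> = fact (k + 1) *\<^sub>R (a * u x ^ k) *\<^sub>C x"
      unfolding scaleC_of_real[symmetric] scaleC_scaleC by (simp del: fact_Suc)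
    finally show ?thesis by (simp del: fact_Suc)
  qed
  then show "\<exists>H. homogeneous_polynomial k H \<and>
      (\<forall>x. fderiv_pow0 (k + 1) F x /\<^sub>R fact (k + 1) = H x *\<^sub>C x)"
    using homogeneous_polynomial_power[OF u u_le, of k a] by (intro exI[of _ "\<lambda>x. a * u x ^ k"]) auto
qed

end

text \<open>The function \<open>z h(z)\<close> is the one-dimensional extremal: \<open>h / (z h)' = (1 + e\<^sup>2\<^sup>i\<^sup>\<beta> z\<^sup>2) / (1 - z\<^sup>2)\<close>.\<close>

lemma extremal_function:
  fixes \<gamma> :: complex
  assumes \<gamma>: "cmod \<gamma> = 1"
  obtains h where "h holomorphic_on ball 0 1" "h 0 = 1"
    "\<And>z. cmod z < 1 \<Longrightarrow> h z \<noteq> 0"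
    "\<And>z. cmod z < 1 \<Longrightarrow> (1 + \<gamma> * z\<^sup>2) * (h z + z * deriv h z) = (1 - z\<^sup>2) * h z"
    "fps_nth (fps_expansion h 0) 1 = 0"
    "fps_nth (fps_expansion h 0) 2 = - (1 + \<gamma>) / 2"
    "fps_nth (fps_expansion h 0) 3 = 0"
proof -
  have \<gamma>0: "\<gamma> \<noteq> 0" using \<gamma> by auto
  have Re: "Re (1 + \<gamma> * z\<^sup>2) > 0" if "cmod z < 1" for z
  proof -
    have "cmod (\<gamma> * z\<^sup>2) < 1" using that \<gamma> by (simp add: norm_mult norm_power abs_square_less_1)
    then show ?thesis using abs_Re_le_cmod[of "\<gamma> * z\<^sup>2"] by simp
  qed
  have nz: "1 + \<gamma> * z\<^sup>2 \<noteq> 0" if "cmod z < 1" for z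
    using Re[OF that] by (metis less_irrefl zero_complex.simps(1))
  have np: "1 + \<gamma> * z\<^sup>2 \<notin> \<real>\<^sub>\<le>\<^sub>0" if "cmod z < 1" for z
    using Re[OF that] by (auto simp: complex_nonpos_Reals_iff)
  \<comment> \<open>Exponent of h = (1 + \<gamma> z^2)^k: the required quotient amounts to h' / h =
    - (1 + \<gamma>) z / (1 + \<gamma> z^2), whose primitive is k Ln (1 + \<gamma> z^2) with this
    k.\<close>
  define k where "k = - (1 + \<gamma>) / (2 * \<gamma>)"
  define h where "h z = exp (k * Ln (1 + \<gamma> * z\<^sup>2))" for z
  have h: "h holomorphic_on ball 0 1"
    unfolding h_def by (intro holomorphic_intros) (use np in auto)
  have der: "(h has_field_derivative (- (1 + \<gamma>) * z / (1 + \<gamma> * z\<^sup>2) * h z)) (at z)" if "cmod z < 1" for z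
  proof -
    have "((\<lambda>z. 1 + \<gamma> * z\<^sup>2) has_field_derivative 2 * \<gamma> * z) (at z)"
      by (auto intro!: derivative_eq_intros)
    from DERIV_chain2[OF has_field_derivative_Ln[OF np[OF that]] this]
    have "((\<lambda>z. Ln (1 + \<gamma> * z\<^sup>2)) has_field_derivative inverse (1 + \<gamma> * z\<^sup>2) * (2 * \<gamma> * z)) (at z)" .
    from DERIV_chain2[OF DERIV_exp DERIV_cmult[OF this, of k]]
    have "(h has_field_derivative h z * (k * (inverse (1 + \<gamma> * z\<^sup>2) * (2 * \<gamma> * z)))) (at z)"
      unfolding h_def .
    moreover have k: "k * (2 * \<gamma>) = - (1 + \<gamma>)" using \<gamma>0 by (simp add: k_def)
    have "h z * (k * (inverse (1 + \<gamma> * z\<^sup>2) * (2 * \<gamma> * z))) =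
        (k * (2 * \<gamma>)) * z * inverse (1 + \<gamma> * z\<^sup>2) * h z"
      by (simp only: mult_ac)
    then have "h z * (k * (inverse (1 + \<gamma> * z\<^sup>2) * (2 * \<gamma> * z))) = - (1 + \<gamma>) * z / (1 + \<gamma> * z\<^sup>2) * h z"
      unfolding k divide_inverse .
    ultimately show ?thesis by (simp only:)
  qed
  \<comment> \<open>Without denominators, the differential equation becomes a linear recursion for
    the coefficients of h.\<close>
  have ode: "(1 + \<gamma> * z\<^sup>2) * deriv h z = - (1 + \<gamma>) * (z * h z)" if "cmod z < 1" for z
    using DERIV_imp_deriv[OF der[OF that]] nz[OF that] by simp
  define H where "H = fps_expansion h 0"
  have H: "h has_fps_expansion H" unfolding H_def by (rule has_fps_expansion_disc[OF h])
  have H0: "fps_nth H 0 = 1" using fps_expansion_0[OF h] by (simp add: H_def h_def)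
  have "(1 + fps_const \<gamma> * fps_X\<^sup>2) * fps_deriv H = fps_const (- (1 + \<gamma>)) * (fps_X * H)"
    by (rule fps_eq_on_disc[OF _ _ ode]) (auto intro!: fps_expansion_intros H)
  then have "fps_deriv H + fps_const \<gamma> * (fps_X * (fps_X * fps_deriv H)) = fps_const (- (1 + \<gamma>)) * (fps_X * H)"
    by (simp add: power2_eq_square algebra_simps)
  then have coef: "fps_nth (fps_deriv H + fps_const \<gamma> * (fps_X * (fps_X * fps_deriv H))) n =
      fps_nth (fps_const (- (1 + \<gamma>)) * (fps_X * H)) n" for n by simp
  have H1: "fps_nth H 1 = 0" using coef[of 0] by simp
  have H2: "fps_nth H 2 = - (1 + \<gamma>) / 2"
    using coef[of 1] H0 by (simp add: numeral_2_eq_2 field_simps)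
  have H3: "fps_nth H 3 = 0"
    using coef[of 2] H1 by (simp add: numeral_3_eq_3 numeral_2_eq_2)
  show ?thesis
  proof (rule that[OF h])
    show "(1 + \<gamma> * z\<^sup>2) * (h z + z * deriv h z) = (1 - z\<^sup>2) * h z" if "cmod z < 1" for z
    proof -
      have "(1 + \<gamma> * z\<^sup>2) * (h z + z * deriv h z) = (1 + \<gamma> * z\<^sup>2) * h z + z * ((1 + \<gamma> * z\<^sup>2) * deriv h z)"
        by (simp add: algebra_simps)
      then show ?thesis unfolding ode[OF that] by (simp add: power2_eq_square algebra_simps)
    qed
  qed (use H1 H2 H3 in \<open>simp_all add: h_def H_def\<close>)
qed

text \<open>The extremal h is a function of z^2, so A_2 = A_4 = 0, and the determinant is - A_3^2
  with A_3 = - (1 + \<gamma>) / 2 = - e^(i \<beta>) cos \<beta>.\<close>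

lemma spirallike_sharp:
  fixes x\<^sub>0 :: "'a::complex_banach"
  assumes \<beta>: "cos \<beta> > 0" and x0: "norm x\<^sub>0 = 1" and u: "u \<in> support_functionals x\<^sub>0"
  obtains F :: "'a \<Rightarrow> 'a" where "F \<in> spirallike \<beta>" "radial_terms F"
    "cmod (hankel22 F x\<^sub>0 u) = (cos \<beta>)\<^sup>2"
proof -
  define e where "e = exp (\<i> * of_real \<beta>)"
  have e: "cmod e = 1" "Re e = cos \<beta>" by (auto simp: e_def norm_exp Re_exp)
  have e': "exp (- (\<i> * of_real \<beta>)) = cnj e" "cnj e * e = 1"
    by (auto simp: e_def exp_cnj exp_add[symmetric])
  define \<gamma> where "\<gamma> = e\<^sup>2"
  have "cmod \<gamma> = 1" by (simp add: \<gamma>_def norm_power e)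
  then obtain h where ext: "h holomorphic_on ball 0 1" "h 0 = 1"
    "\<And>z. cmod z < 1 \<Longrightarrow> h z \<noteq> 0"
    "\<And>z. cmod z < 1 \<Longrightarrow> (1 + \<gamma> * z\<^sup>2) * (h z + z * deriv h z) = (1 - z\<^sup>2) * h z"
    and H: "fps_nth (fps_expansion h 0) 1 = 0" "fps_nth (fps_expansion h 0) 2 = - (1 + \<gamma>) / 2"
    "fps_nth (fps_expansion h 0) 3 = 0"
    using extremal_function by blast
  have bu: "bounded_clinear u" and ux0: "u x\<^sub>0 = 1" using u x0 by (auto simp: support_functionals_def)
  interpret radial_map u h
    by unfold_locales (use bu support_functional_norm_le[OF u] ext in auto)
  have less: "cmod (z\<^sup>2) < 1" if "cmod z < 1" for z
    using that by (simp add: norm_power abs_square_less_1)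
  have nz1: "1 - z\<^sup>2 \<noteq> 0" if "cmod z < 1" for z
    using less[OF that] by (metis eq_iff_diff_eq_0 less_irrefl norm_one)
  have nz2: "h z + z * deriv h z \<noteq> 0" if "cmod z < 1" for z
    using ext(4)[OF that] ext(3)[OF that] nz1[OF that] by (metis mult_eq_0_iff)
  have quot: "h z / (h z + z * deriv h z) = (1 + \<gamma> * z\<^sup>2) / (1 - z\<^sup>2)" if "cmod z < 1" for z
    using ext(4)[OF that] nz1[OF that] nz2[OF that] by (simp add: frac_eq_eq mult.commute)
  have pos: "Re (cnj e * ((1 + \<gamma> * z\<^sup>2) / (1 - z\<^sup>2))) > 0" if z: "cmod z < 1" for z
  proof -
    define w where "w = z\<^sup>2"
    have w: "cmod w < 1" "1 - w \<noteq> 0" using less[OF z] nz1[OF z] by (auto simp: w_def)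
    have "cnj e * (1 + \<gamma> * w) = cnj e + (cnj e * e) * (e * w)"
      by (simp add: \<gamma>_def power2_eq_square algebra_simps)
    then have "cnj e * ((1 + \<gamma> * w) / (1 - w)) = (cnj e + e * w) / (1 - w)"
      by (simp add: e')
    \<comment> \<open>In the expansion e w and its conjugate occur with opposite signs and
      contribute no real part.\<close>
    moreover have "Re ((cnj e + e * w) * cnj (1 - w)) = Re e * (1 - (cmod w)\<^sup>2)"
      by (simp only: cmod_power2) (simp add: algebra_simps power2_eq_square)
    moreover have "(cmod w)\<^sup>2 < 1" using w by (simp add: abs_square_less_1)
    ultimately have "Re (cnj e * ((1 + \<gamma> * w) / (1 - w))) > 0"
      using \<beta> e by (simp only: Re_complex_div_gt_0) simp
    then show ?thesis by (simp only: w_def)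
  qed
  have "F \<in> spirallike \<beta>"
    unfolding spirallike_def mem_Collect_eq normalized_def locally_biholomorphic_def
  proof (intro conjI ballI)
    show "holomorphic_on_ball F" "holomorphic_on_ball F"
      using F_holomorphic by (simp_all add: holomorphic_on_ball_def holomorphic_map_on_def)
    have u0: "u 0 = 0" using u_scaleC[of 0 0] by simp
    show "F 0 = 0" by (simp add: F_def)
    show "fderiv F 0 = id_blinfun" by (rule blinfun_eqI) (simp add: fderiv_F u0 ext(2))
  next
    fix x :: 'a assume "x \<in> ball 0 1"
    then show "\<exists>G. G o\<^sub>L fderiv F x = id_blinfun \<and> fderiv F x o\<^sub>L G = id_blinfun"
      by (intro fderiv_F_inverse ext(3) nz2 u_less_1)
  next
    fix x :: 'a and T assume x: "x \<in> ball 0 1 - {0}" and T: "T \<in> support_functionals x"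
    then have bT: "bounded_clinear T" "T x = of_real (norm x)" by (auto simp: support_functionals_def)
    have ux: "cmod (u x) < 1" using x u_less_1 by blast
    \<comment> \<open>This vector is a multiple of x, so every support functional at x gives norm x
      times the same scalar.\<close>
    have "inv (blinfun_apply (fderiv F x)) (F x) = ((1 + \<gamma> * (u x)\<^sup>2) / (1 - (u x)\<^sup>2)) *\<^sub>C x"
      using fderiv_F_inverse(2)[of x] x ext(3)[OF ux] nz2[OF ux] quot[OF ux] by simp
    then have "exp (- (\<i> * of_real \<beta>)) * T (inv (blinfun_apply (fderiv F x)) (F x)) =
        of_real (norm x) * (cnj e * ((1 + \<gamma> * (u x)\<^sup>2) / (1 - (u x)\<^sup>2)))"
      by (simp add: e' bounded_clinear_scaleC[OF bT(1)] scaleC_complex_def bT(2))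
    moreover have "Re (of_real (norm x) * c) = norm x * Re c" for c by simp
    ultimately show "Re (exp (- (\<i> * of_real \<beta>)) * T (inv (blinfun_apply (fderiv F x)) (F x))) > 0"
      using pos[OF ux] x by (simp only: mult_pos_pos) simp
  qed
  moreover have "cmod (hankel22 F x\<^sub>0 u) = (cos \<beta>)\<^sup>2"
  proof -
    have A: "coeff_A F x\<^sub>0 u (Suc k) = fps_nth (fps_expansion h 0) k" if "k \<le> 3" for k
      using fderiv_pow0_F_Suc[OF that, of x\<^sub>0]
      by (simp add: coeff_A_def u_scaleC ux0 del: fact_Suc)
    have "hankel22 F x\<^sub>0 u = - ((1 + \<gamma>) / 2)\<^sup>2"
    proof -
      have A2: "coeff_A F x\<^sub>0 u 2 = 0" using A[of 1] H(1) by (simp add: numeral_2_eq_2)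
      have A3: "coeff_A F x\<^sub>0 u 3 = - (1 + \<gamma>) / 2" using A[of 2] H(2) by (simp add: numeral_3_eq_3)
      show ?thesis unfolding hankel22_def A2 A3 by (simp add: field_simps power2_eq_square)
    qed
    also have "1 + \<gamma> = e * (cnj e + e)" using e' by (simp add: \<gamma>_def power2_eq_square algebra_simps)
    also have "cnj e + e = of_real (2 * cos \<beta>)"
      using e by (simp add: complex_eq_iff)
    finally show ?thesis by (simp add: norm_mult norm_power norm_divide e power_divide power_mult_distrib)
  qed
  ultimately show ?thesis using radial_terms_F that by blast
qed

theorem theorem3p2:
  fixes \<beta> :: real
  assumes nonzero: "\<exists>x::'a::complex_banach. x \<noteq> 0"
    and beta: "\<bar>\<beta>\<bar> \<le> pi / 3"
  shows "(\<forall>F :: 'a \<Rightarrow> 'a.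
            locally_biholomorphic F \<longrightarrow> radial_terms F \<longrightarrow> F \<in> spirallike \<beta> \<longrightarrow>
            (\<forall>x\<^sub>0. norm x\<^sub>0 = 1 \<longrightarrow>
              (\<forall>T\<in>support_functionals x\<^sub>0. cmod (hankel22 F x\<^sub>0 T) \<le> (cos \<beta>)\<^sup>2)))
       \<and> (\<exists>F :: 'a \<Rightarrow> 'a.
            locally_biholomorphic F \<and> F \<in> spirallike \<beta> \<and> radial_terms F \<and>
            (\<exists>x\<^sub>0. norm x\<^sub>0 = 1 \<and>
              (\<exists>T\<in>support_functionals x\<^sub>0. cmod (hankel22 F x\<^sub>0 T) = (cos \<beta>)\<^sup>2)))"
proof -
  have \<beta>: "cos \<beta> > 0" using beta pi_gt_zero by (intro cos_gt_zero_pi) linarith+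
  obtain y :: 'a where "y \<noteq> 0" using nonzero by blast
  define x\<^sub>0 where "x\<^sub>0 = sgn y"
  have x0: "norm x\<^sub>0 = 1" using \<open>y \<noteq> 0\<close> by (simp add: x\<^sub>0_def norm_sgn)
  then have "x\<^sub>0 \<noteq> 0" by auto
  then obtain u where u: "u \<in> support_functionals x\<^sub>0" by (rule support_functional_exists)
  obtain F :: "'a \<Rightarrow> 'a" where F: "F \<in> spirallike \<beta>" "radial_terms F"
    "cmod (hankel22 F x\<^sub>0 u) = (cos \<beta>)\<^sup>2"
    by (rule spirallike_sharp[OF \<beta> x0 u])
  have "locally_biholomorphic F" using F(1) by (simp add: spirallike_def)
  with F x0 u spirallike_hankel_bound[OF _ _ \<beta>] show ?thesis by blast
qed

end
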